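(* Let $a\in(1/2,1)$. The random variable $L_1$, the almost sure limit of $n^{-a}S_n$ for the elephant random walk $(S_n)$ with memory parameter $p=(1+a)/2$ and first step parameter $q=1$, is unimodal.
   Context: Elephant random walk (ERW) with memory parameter $p\in[0,1]$ and first step parameter $q\in[0,1]$: $S_0=0$; the first step is $X_1=+1$ with probability $q$ and $X_1=-1$ with probability $1-q$; for $n\ge 1$, $X_{n+1}=+X_{\mathcal U(n)}$ with probability $p$ and $X_{n+1}=-X_{\mathcal U(n)}$ with probability $1-p$, where $\mathcal U(n)$ is an independent uniform random variable on $\{1,\dots,n\}$; $S_1=X_1$ and $S_{n+1}=S_n+X_{n+1}$. Set $a=2p-1$. For $a\in(1/2,1)$ (superdiffusive regime) it is known that $n^{-a}S_n$ converges almost surely to a non-degenerate, non-Gaussian random variable $L_q$; $L_1$ is this limit when $q=1$. It is known that $L_1$ has a density function $\varphi$ on $\mathbb R$. The unimodality of $L_1$ means that the function $\varphi$ has a unique local maximum. *)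

theory Defs
  imports "HOL-Probability.Probability"
begin

(* The sources of randomness of the walk: the first step, the remembered times U(n) and the
   signs E(n) that decide whether the remembered step is repeated or reversed. *)
datatype erw_input = First_Step | Memory nat | Sign nat

definition sign_pmf :: "real \<Rightarrow> int pmf" where
  "sign_pmf r = map_pmf (\<lambda>b. if b then 1 else - 1) (bernoulli_pmf r)"

(* Steps are X 1, X 2, ...; the values X 0, U 0 and E 0 are irrelevant.
   All inputs are viewed as integer-valued only because indep_vars needs one value type. *)
locale elephant_random_walk = prob_space M
  for M :: "'a measure" and p q :: real
    and X :: "nat \<Rightarrow> 'a \<Rightarrow> int" and U :: "nat \<Rightarrow> 'a \<Rightarrow> nat" and E :: "nat \<Rightarrow> 'a \<Rightarrow> int" +
  assumes p_range: "0 \<le> p" "p \<le> 1"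
    and q_range: "0 \<le> q" "q \<le> 1"
    and X_measurable: "n \<ge> 1 \<Longrightarrow> X n \<in> measurable M (count_space UNIV)"
    and U_measurable: "n \<ge> 1 \<Longrightarrow> U n \<in> measurable M (count_space UNIV)"
    and E_measurable: "n \<ge> 1 \<Longrightarrow> E n \<in> measurable M (count_space UNIV)"
    and first_step_distr: "distr M (count_space UNIV) (X 1) = measure_pmf (sign_pmf q)"
    and U_distr: "n \<ge> 1 \<Longrightarrow> distr M (count_space UNIV) (U n) = measure_pmf (pmf_of_set {1..n})"
    and E_distr: "n \<ge> 1 \<Longrightarrow> distr M (count_space UNIV) (E n) = measure_pmf (sign_pmf p)"
    and inputs_indep:
      "indep_vars (\<lambda>_. count_space UNIV)
         (\<lambda>i \<omega>. case i of First_Step \<Rightarrow> X 1 \<omega> | Memory n \<Rightarrow> int (U n \<omega>) | Sign n \<Rightarrow> E n \<omega>)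
         ({First_Step} \<union> Memory ` {1..} \<union> Sign ` {1..})"
    and next_step: "n \<ge> 1 \<Longrightarrow> AE \<omega> in M. X (Suc n) \<omega> = E n \<omega> * X (U n \<omega>) \<omega>"

definition walk_position :: "(nat \<Rightarrow> 'a \<Rightarrow> int) \<Rightarrow> nat \<Rightarrow> 'a \<Rightarrow> int" where
  "walk_position X n \<omega> = (\<Sum>k=1..n. X k \<omega>)"

definition local_maximum :: "(real \<Rightarrow> real) \<Rightarrow> real \<Rightarrow> bool" where
  "local_maximum f x \<longleftrightarrow> (\<forall>\<^sub>F y in nhds x. f y \<le> f x)"

(* A density is only determined almost everywhere, whereas local maxima depend on its pointwise
   values. The density meant here is the continuous one, which is unique if it exists. *)
definition unimodal :: "'a measure \<Rightarrow> ('a \<Rightarrow> real) \<Rightarrow> bool" where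
  "unimodal M L \<longleftrightarrow>
     (\<exists>\<phi>. continuous_on UNIV \<phi> \<and> (\<forall>x. 0 \<le> \<phi> x) \<and>
          distributed M lborel L (\<lambda>x. ennreal (\<phi> x)) \<and> (\<exists>!x. local_maximum \<phi> x))"

end

theory Submission
  imports Defs "HOL-Complex_Analysis.Complex_Analysis" "HOL-Real_Asymp.Real_Asymp"
begin

text \<open>Let \<open>\<pi>\<^sub>n(k)\<close> be the probability that \<open>k\<close> of the first \<open>n\<close> steps are \<open>+1\<close>. Since the probability
  \<open>r\<^sub>n(k)\<close> of another such step is affine in \<open>k\<close>, the \<open>j\<close>-th difference \<open>D\<^sub>n\<close> of \<open>\<pi>\<^sub>n\<close> again satisfies
  a two-term recursion \<open>D\<^bsub>n+1\<^esub>(k) = (1 - r\<^sub>n(k)) D\<^sub>n(k) + r\<^sub>n(k-1-j) D\<^sub>n(k-1)\<close>. For \<open>j = 1\<close> this shows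
  that the number of sign changes of the differences does not grow, so that every \<open>\<pi>\<^sub>n\<close> is unimodal.
  For general \<open>j\<close> the two weights that multiply a given \<open>D\<^sub>n(k)\<close> add up to \<open>1 - ja/n\<close>, so that the
  \<open>l\<^sup>1\<close> norm of the \<open>j\<close>-th difference is at most \<open>2\<^sup>j (cj)\<^bsup>ja\<^esup> n\<^bsup>-ja\<^esup>\<close>. In the limit, the
  characteristic function of \<open>L\<^sub>1\<close> at \<open>t\<close> is bounded by \<open>(cj)\<^bsup>ja\<^esup> / \<bar>t\<bar>\<^sup>j\<close> for every \<open>j\<close>. As \<open>a < 1\<close>, its
  Fourier inverse is a density given by an everywhere convergent power series, hence constant on no
  interval. This density inherits quasi-concavity from the \<open>\<pi>\<^sub>n\<close>, so it has a single local maximum.\<close>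

section \<open>The law of the number of positive steps\<close>

text \<open>With \<open>p = (1 + a) / 2\<close> this is
  \<open>p * k / n + (1 - p) * (n - k) / n\<close>, the chance that the next step is +1 when
  \<open>k\<close> of the first \<open>n\<close> are. It is kept as an affine function on all
  integers, even where its value leaves the unit interval.\<close>

definition up_prob :: "real \<Rightarrow> nat \<Rightarrow> int \<Rightarrow> real" where
  "up_prob a n k = (1 - a) / 2 + a * real_of_int k / real n"

text \<open>The first step is +1 because \<open>q = 1\<close>; hence the exceptional transition from
  \<open>n = 0\<close> to a point mass at 1. Integer arguments let differences run past both ends of
  the support.\<close>

primrec up_law :: "real \<Rightarrow> nat \<Rightarrow> int \<Rightarrow> real" where
  "up_law a 0 k = of_bool (k = 0)"
| "up_law a (Suc n) k = (if n = 0 then of_bool (k = 1)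
     else (1 - up_prob a n k) * up_law a n k + up_prob a n (k - 1) * up_law a n (k - 1))"

definition bdiff :: "(int \<Rightarrow> real) \<Rightarrow> int \<Rightarrow> real" where
  "bdiff f k = f k - f (k - 1)"

lemma up_law_step:
  "n \<ge> 1 \<Longrightarrow> up_law a (Suc n) k
     = (1 - up_prob a n k) * up_law a n k + up_prob a n (k - 1) * up_law a n (k - 1)"
  by simp

declare up_law.simps(2)[simp del]

lemma up_prob_nonneg:
  assumes "0 < a" "a < 1" "0 \<le> k"
  shows "0 \<le> up_prob a n k"
  using assms by (simp add: up_prob_def)

lemma up_prob_le_1:
  assumes "0 < a" "a < 1" "k \<le> int n"
  shows "up_prob a n k \<le> 1"
proof (cases "n = 0")
  case False
  then have "real_of_int k / real n \<le> 1"
    using assms by (simp add: field_simps)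
  then have "a * (real_of_int k / real n) \<le> a * 1"
    using assms by (intro mult_left_mono) auto
  moreover have "(1 - a) / 2 + x \<le> 1" if "x \<le> a * 1" for x
    using that assms(2) by (simp add: field_simps)
  ultimately show ?thesis
    by (simp add: up_prob_def)
qed (use assms in \<open>simp add: up_prob_def\<close>)

lemma up_law_support:
  assumes "n \<ge> 1" "k < 1 \<or> int n < k"
  shows "up_law a n k = 0"
  using assms
proof (induction n arbitrary: k rule: nat_induct_at_least)
  case base
  then show ?case by (auto simp: up_law.simps)
next
  case (Suc n)
  then show ?case 
    by (auto simp: up_law_step)
qed

text \<open>A weight of the recursion can be negative only where the value that it multiplies
  vanishes, by \<open>up_law_support\<close>.\<close>

lemma up_law_nonneg:
  assumes "0 < a" "a < 1" "n \<ge> 1"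
  shows "0 \<le> up_law a n k"
  using assms(3)
proof (induction n arbitrary: k rule: nat_induct_at_least)
  case base
  then show ?case by (simp add: up_law.simps)
next
  case (Suc n)
  have "0 \<le> (1 - up_prob a n k) * up_law a n k"
    using Suc up_law_support[of n k a] up_prob_le_1[of a k n] assms
    by (cases "k \<le> int n") auto
  moreover have "0 \<le> up_prob a n (k - 1) * up_law a n (k - 1)"
    using Suc up_law_support[of n "k - 1" a] up_prob_nonneg[of a "k - 1" n] assms
    by (cases "k - 1 \<ge> 0") auto
  ultimately show ?case
    using Suc by (simp add: up_law_step)
qed

lemma sum_int_shift:
  fixes f :: "int \<Rightarrow> 'b::comm_monoid_add"
  shows "(\<Sum>k\<in>{a..b}. f (k - 1)) = (\<Sum>k\<in>{a - 1..b - 1}. f k)"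
  by (rule sum.reindex_bij_witness[of _ "\<lambda>k. k + 1" "\<lambda>k. k - 1"]) auto

lemma sum_int_extend:
  fixes f :: "int \<Rightarrow> 'b::comm_monoid_add"
  assumes "\<And>k. k < a \<or> b < k \<Longrightarrow> f k = 0" "c \<le> a" "b \<le> d"
  shows "(\<Sum>k\<in>{c..d}. f k) = (\<Sum>k\<in>{a..b}. f k)"
  using assms by (intro sum.mono_neutral_right) auto

section \<open>Iterated backward differences of the law\<close>

lemma bdiff_iter_Suc: "(bdiff ^^ Suc j) f k = (bdiff ^^ j) f k - (bdiff ^^ j) f (k - 1)"
  by (simp add: bdiff_def[of "(bdiff ^^ j) f"])

lemma bdiff_iter_support:
  assumes "n \<ge> 1" "k < 1 \<or> int n + int j < k"
  shows "(bdiff ^^ j) (up_law a n) k = 0"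
  using assms(2)
proof (induction j arbitrary: k)
  case 0
  then show ?case using up_law_support[OF assms(1)] by auto
next
  case (Suc j)
  then show ?case by (auto simp: bdiff_def)
qed

text \<open>Differencing once more keeps the two-term shape: since \<open>up_prob\<close> is affine
  in \<open>k\<close>, the two increments in the mixed term both equal \<open>a / n\<close> and
  cancel. Only the shift in the second weight grows with \<open>j\<close>.\<close>

lemma bdiff_iter_step:
  assumes "n \<ge> 1"
  shows "(bdiff ^^ j) (up_law a (Suc n)) k
    = (1 - up_prob a n k) * (bdiff ^^ j) (up_law a n) k
      + up_prob a n (k - 1 - int j) * (bdiff ^^ j) (up_law a n) (k - 1)"
proof (induction j arbitrary: k)
  case 0
  then show ?case using assms by (simp add: up_law_step)
next
  case (Suc j)
  let ?D = "(bdiff ^^ j) (up_law a n)"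
  have "(bdiff ^^ Suc j) (up_law a (Suc n)) k
    = (1 - up_prob a n k) * ?D k + up_prob a n (k - 1 - int j) * ?D (k - 1)
      - ((1 - up_prob a n (k - 1)) * ?D (k - 1)
         + up_prob a n (k - 2 - int j) * ?D (k - 2))"
    by (simp add: bdiff_iter_Suc Suc del: funpow.simps)
  also have "\<dots> = (1 - up_prob a n k) * (?D k - ?D (k - 1))
      + up_prob a n (k - 2 - int j) * (?D (k - 1) - ?D (k - 2))
      + ?D (k - 1) * (up_prob a n (k - 1 - int j) + up_prob a n (k - 1)
          - up_prob a n k - up_prob a n (k - 2 - int j))"
    by (simp add: algebra_simps)
  also have "up_prob a n (k - 1 - int j) + up_prob a n (k - 1)
          - up_prob a n k - up_prob a n (k - 2 - int j) = 0"
    by (simp add: up_prob_def add_divide_distrib diff_divide_distrib algebra_simps)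
  finally show ?case
    unfolding bdiff_iter_Suc by (simp add: algebra_simps)
qed

text \<open>The coefficient of \<open>bdiff_iter_step\<close> at \<open>k = n + 1\<close> is negative for small \<open>n\<close>, so that the
  variation argument fails there; \<open>up_law_top\<close> makes up for it.\<close>

lemma up_law_top_step:
  assumes "n \<ge> 1"
  shows "up_law a (Suc n) (int (Suc n)) = (1 + a) / 2 * up_law a n (int n)"
  using assms up_law_support[of n "1 + int n" a]
  by (simp add: up_law_step up_prob_def field_simps)

lemma up_law_below_top_step:
  assumes "n \<ge> 1"
  shows "up_law a (Suc n) (int n) = (1 - a) / 2 * up_law a n (int n)
    + ((1 + a) / 2 - a / real n) * up_law a n (int n - 1)"
  using assms by (simp add: up_law_step up_prob_def field_simps)

lemma up_law_top:
  assumes "0 < a" "a < 1" "n \<ge> 1"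
  shows "a * up_law a n (int n - 1) \<le> (1 - a) / 2 * real n * up_law a n (int n)"
  using assms(3)
proof (induction n rule: nat_induct_at_least)
  case base
  then show ?case using assms by (simp add: up_law.simps)
next
  case (Suc n)
  have int_Suc_diff: "int (Suc n) - 1 = int n" by simp
  define s t where "s = up_law a n (int n - 1)" and "t = up_law a n (int n)"
  have t: "0 \<le> t" unfolding t_def using up_law_nonneg Suc assms by auto
  have c: "0 \<le> (1 + a) / 2 - a / real n"
  proof -
    have "a / real n \<le> a / 1" using Suc assms by (intro divide_left_mono) auto
    moreover have "0 \<le> (1 + a) / 2 - x" if "x \<le> a / 1" for x
      using that assms(2) by (simp add: field_simps)
    ultimately show ?thesis by blast
  qed
  have "a * up_law a (Suc n) (int n) = a * (1 - a) / 2 * t + ((1 + a) / 2 - a / real n) * (a * s)"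
    by (subst up_law_below_top_step[OF Suc(1)]) (simp add: s_def t_def distrib_left mult_ac)
  also have "\<dots> \<le> a * (1 - a) / 2 * t + ((1 + a) / 2 - a / real n) * ((1 - a) / 2 * real n * t)"
    using c Suc by (intro add_left_mono mult_left_mono) (auto simp: s_def t_def)
  \<comment> \<open>The part \<open>- a / n\<close> of the coefficient, multiplied by
    \<open>n\<close>, cancels the first summand exactly.\<close>
  also have "\<dots> = (1 - a) / 2 * real n * ((1 + a) / 2 * t)"
    using Suc by (simp add: field_simps)
  also have "\<dots> \<le> (1 - a) / 2 * real (Suc n) * ((1 + a) / 2 * t)"
    using assms t by (intro mult_right_mono mult_left_mono) auto
  finally show ?case
    unfolding up_law_top_step[OF Suc(1)] t_def by (simp only: int_Suc_diff)
qed

section \<open>Unimodality at finite times\<close>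

text \<open>A difference at time \<open>n + 1\<close> combines the old difference at the same place
  with the one to its left. Nonnegative weights keep the sign for \<open>k \<le> m\<close> and for
  \<open>k > m + 1\<close>, so the mode can be taken at \<open>m\<close> or at
  \<open>m + 1\<close>.\<close>

lemma up_law_unimodal:
  assumes "0 < a" "a < 1" "n \<ge> 1"
  obtains m where "1 \<le> m" "m \<le> int n"
    "\<And>k. k \<le> m \<Longrightarrow> 0 \<le> bdiff (up_law a n) k" "\<And>k. m < k \<Longrightarrow> bdiff (up_law a n) k \<le> 0"
proof -
  have "\<exists>m. 1 \<le> m \<and> m \<le> int n \<and> (\<forall>k\<le>m. 0 \<le> bdiff (up_law a n) k) \<and> (\<forall>k>m. bdiff (up_law a n) k \<le> 0)"
    using assms(3)
  proof (induction n rule: nat_induct_at_least)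
    case base
    show ?case by (rule exI[of _ 1]) (auto simp: bdiff_def up_law.simps)
  next
    case (Suc n)
    then obtain m where m: "1 \<le> m" "m \<le> int n" 
      and pos: "\<And>k. k \<le> m \<Longrightarrow> 0 \<le> bdiff (up_law a n) k"
      and neg: "\<And>k. m < k \<Longrightarrow> bdiff (up_law a n) k \<le> 0" by auto
    have step: "bdiff (up_law a (Suc n)) k = (1 - up_prob a n k) * bdiff (up_law a n) k
        + up_prob a n (k - 2) * bdiff (up_law a n) (k - 1)" for k
      using bdiff_iter_step[of n 1 a k] Suc by simp
    have supp: "bdiff (up_law a n) k = 0" if "k < 1 \<or> int n + 1 < k" for k
      using bdiff_iter_support[of n k 1 a] Suc that by simp
    have pos': "0 \<le> bdiff (up_law a (Suc n)) k" if "k \<le> m" for k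
    proof -
      have "0 \<le> (1 - up_prob a n k) * bdiff (up_law a n) k"
        using pos[of k] up_prob_le_1[of a k n] that m assms by auto
      moreover have "0 \<le> up_prob a n (k - 2) * bdiff (up_law a n) (k - 1)"
        using pos[of "k - 1"] up_prob_nonneg[of a "k - 2" n] that supp[of "k - 1"] assms
        by (cases "k \<ge> 2") auto
      ultimately show ?thesis unfolding step by simp
    qed
    have neg': "bdiff (up_law a (Suc n)) k \<le> 0" if k: "m + 1 < k" for k
    proof -
      consider "k \<le> int n" | "k = int n + 1" | "k > int n + 1" by linarith
      then show ?thesis
      proof cases
        \<comment> \<open>Here the first weight is \<open>(1 - a) / 2 - a / n\<close>, possibly
          negative. The two topmost values of the new law are therefore compared directly, with
          \<open>up_law_top\<close> absorbing the term in \<open>a / n\<close>.\<close>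
        case 2
        have "bdiff (up_law a n) (int n) \<le> 0"
          using neg 2 k by auto
        then have "up_law a n (int n) \<le> up_law a n (int n - 1)"
          by (simp add: bdiff_def)
        then have "(1 + a) / 2 * up_law a n (int n) \<le> (1 + a) / 2 * up_law a n (int n - 1)"
          using assms by (intro mult_left_mono) auto
        moreover have "a / real n * up_law a n (int n - 1) \<le> (1 - a) / 2 * up_law a n (int n)"
          using up_law_top[of a n] assms Suc by (simp add: field_simps)
        moreover have "(1 - a) / 2 * up_law a n (int n)
            + ((1 + a) / 2 - a / real n) * up_law a n (int n - 1)
          = (1 - a) / 2 * up_law a n (int n) + (1 + a) / 2 * up_law a n (int n - 1)
            - a / real n * up_law a n (int n - 1)"
          by (simp add: left_diff_distrib)
        ultimately have "up_law a (Suc n) (int (Suc n)) \<le> up_law a (Suc n) (int n)"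
          using up_law_top_step[of n a] up_law_below_top_step[of n a] Suc(1) by linarith
        then show ?thesis
          using 2 by (simp add: bdiff_def add.commute)
      next
        case 1
        have "(1 - up_prob a n k) * bdiff (up_law a n) k \<le> 0"
          using neg[of k] up_prob_le_1[of a k n] 1 k assms by (intro mult_nonneg_nonpos) auto
        moreover have "up_prob a n (k - 2) * bdiff (up_law a n) (k - 1) \<le> 0"
          using neg[of "k - 1"] up_prob_nonneg[of a "k - 2" n] k m assms
          by (intro mult_nonneg_nonpos) auto
        ultimately show ?thesis unfolding step by simp
      next
        case 3
        have "up_prob a n (k - 2) * bdiff (up_law a n) (k - 1) \<le> 0"
          using neg[of "k - 1"] up_prob_nonneg[of a "k - 2" n] k m assms
          by (intro mult_nonneg_nonpos) auto
        then show ?thesis unfolding step using supp[of k] 3 by simp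
      qed
    qed
    show ?case
    \<comment> \<open>The sign at \<open>m + 1\<close> is the only one left open and decides where
      the new mode lies.\<close>
    proof (cases "0 \<le> bdiff (up_law a (Suc n)) (m + 1)")
      case True
      then show ?thesis using pos' neg' m
        by (intro exI[of _ "m + 1"]) (auto simp: le_less zless_add1_eq)
    next
      case False
      then have "\<forall>k>m. bdiff (up_law a (Suc n)) k \<le> 0"
        using neg' by (metis linorder_not_le nle_le zle_add1_eq_le add.commute order_less_le)
      then show ?thesis using pos' m by (intro exI[of _ m]) auto
    qed
  qed
  then show ?thesis using that by blast
qed

lemma mono_up_to_bdiff:
  fixes f :: "int \<Rightarrow> real"
  assumes "i \<le> j" "\<And>k. i < k \<Longrightarrow> k \<le> j \<Longrightarrow> 0 \<le> bdiff f k"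
  shows "f i \<le> f j"
  using assms
proof (induction j rule: int_ge_induct)
  case (step j)
  then have "f i \<le> f j" by auto
  also have "\<dots> \<le> f (j + 1)" using step(3)[of "j + 1"] step(1) by (simp add: bdiff_def)
  finally show ?case .
qed simp

text \<open>Left of the mode the comparison is with \<open>i\<close>, right of it with
  \<open>k\<close>. Unlike the mode itself, this form refers to no location and so passes to
  averages and limits.\<close>

lemma up_law_quasiconcave:
  assumes "0 < a" "a < 1" "n \<ge> 1" "i \<le> j" "j \<le> k"
  shows "min (up_law a n i) (up_law a n k) \<le> up_law a n j"
proof -
  obtain m where pos: "\<And>k. k \<le> m \<Longrightarrow> 0 \<le> bdiff (up_law a n) k" 
    and neg: "\<And>k. m < k \<Longrightarrow> bdiff (up_law a n) k \<le> 0"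
    using up_law_unimodal[OF assms(1-3)] by metis
  show ?thesis
  proof (cases "j \<le> m")
    case True
    then have "up_law a n i \<le> up_law a n j"
      using assms pos by (intro mono_up_to_bdiff) auto
    then show ?thesis by simp
  next
    case False
    have "- up_law a n j \<le> - up_law a n k"
    proof (rule mono_up_to_bdiff[OF assms(5)])
      fix l assume "j < l" "l \<le> k"
      then show "0 \<le> bdiff (\<lambda>k. - up_law a n k) l"
        using neg[of l] False by (simp add: bdiff_def)
    qed
    then show ?thesis by simp
  qed
qed

lemma up_law_sum:
  assumes "n \<ge> 1"
  shows "(\<Sum>k\<in>{1..int n}. up_law a n k) = 1"
  using assms
proof (induction n rule: nat_induct_at_least)
  case base
  then show ?case by (simp add: up_law.simps)
next
  case (Suc n)
  note supp = up_law_support[OF Suc(1)]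
  have "(\<Sum>k\<in>{1..int (Suc n)}. up_law a (Suc n) k)
     = (\<Sum>k\<in>{1..int (Suc n)}. (1 - up_prob a n k) * up_law a n k)
       + (\<Sum>k\<in>{1..int (Suc n)}. up_prob a n (k - 1) * up_law a n (k - 1))"
    using Suc by (simp add: up_law_step sum.distrib)
  also have "(\<Sum>k\<in>{1..int (Suc n)}. (1 - up_prob a n k) * up_law a n k)
     = (\<Sum>k\<in>{1..int n}. (1 - up_prob a n k) * up_law a n k)"
    by (rule sum_int_extend) (auto simp: supp)
  also have "(\<Sum>k\<in>{1..int (Suc n)}. up_prob a n (k - 1) * up_law a n (k - 1))
     = (\<Sum>k\<in>{1..int n}. up_prob a n k * up_law a n k)"
    by (subst sum_int_shift, rule sum_int_extend) (auto simp: supp)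
  finally show ?case
    using Suc.IH by (simp add: sum.distrib[symmetric] algebra_simps)
qed

section \<open>Decay of the l^1 norms of the differences\<close>

definition diff_norm :: "real \<Rightarrow> nat \<Rightarrow> nat \<Rightarrow> real" where
  "diff_norm a j n = (\<Sum>k\<in>{1..int n + int j}. \<bar>(bdiff ^^ j) (up_law a n) k\<bar>)"

lemma diff_norm_nonneg: "0 \<le> diff_norm a j n"
  by (simp add: diff_norm_def sum_nonneg)

text \<open>Each difference at most doubles the l^1 norm, and \<open>up_law\<close> itself has mass
  1.\<close>

lemma diff_norm_le:
  assumes "0 < a" "a < 1" "n \<ge> 1"
  shows "diff_norm a j n \<le> 2 ^ j"
proof (induction j)
  case 0
  then show ?case
    using up_law_sum[OF assms(3), of a] up_law_nonneg[OF assms(1,2,3)]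
    by (simp add: diff_norm_def)
next
  case (Suc j)
  note supp = bdiff_iter_support[OF assms(3)]
  let ?D = "(bdiff ^^ j) (up_law a n)"
  have "diff_norm a (Suc j) n \<le> (\<Sum>k\<in>{1..int n + int (Suc j)}. \<bar>?D k\<bar> + \<bar>?D (k - 1)\<bar>)"
    unfolding diff_norm_def by (intro sum_mono) (simp add: bdiff_def)
  also have "\<dots> = (\<Sum>k\<in>{1..int n + int (Suc j)}. \<bar>?D k\<bar>) + (\<Sum>k\<in>{1..int n + int (Suc j)}. \<bar>?D (k - 1)\<bar>)"
    by (simp add: sum.distrib)
  also have "(\<Sum>k\<in>{1..int n + int (Suc j)}. \<bar>?D k\<bar>) = diff_norm a j n"
    unfolding diff_norm_def by (rule sum_int_extend) (auto simp: supp)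
  also have "(\<Sum>k\<in>{1..int n + int (Suc j)}. \<bar>?D (k - 1)\<bar>) = diff_norm a j n"
    unfolding diff_norm_def by (subst sum_int_shift, rule sum_int_extend) (auto simp: supp)
  finally show ?case using Suc by simp
qed

text \<open>Regroup by the old index: the value at \<open>k\<close> enters the new value at
  \<open>k\<close> with weight \<open>1 - up_prob a n k\<close> and the new value at
  \<open>k + 1\<close> with weight \<open>up_prob a n (k - j)\<close>. The lower bound on
  \<open>n\<close> makes both weights nonnegative on the support, so their absolute values add up to
  \<open>1 - j * a / n\<close>.\<close>

lemma diff_norm_step:
  assumes "0 < a" "a < 1" "n \<ge> 1" "2 * a * real j \<le> (1 - a) * real n"
  shows "diff_norm a j (Suc n) \<le> (1 - real j * a / real n) * diff_norm a j n"
proof -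
  note supp = bdiff_iter_support[OF assms(3)]
  let ?D = "(bdiff ^^ j) (up_law a n)"
  have "diff_norm a j (Suc n)
     \<le> (\<Sum>k\<in>{1..int (Suc n) + int j}. \<bar>1 - up_prob a n k\<bar> * \<bar>?D k\<bar> + \<bar>up_prob a n (k - 1 - int j)\<bar> * \<bar>?D (k - 1)\<bar>)"
    unfolding diff_norm_def bdiff_iter_step[OF assms(3)]
    by (intro sum_mono) (metis abs_mult abs_triangle_ineq)
  also have "\<dots> = (\<Sum>k\<in>{1..int (Suc n) + int j}. \<bar>1 - up_prob a n k\<bar> * \<bar>?D k\<bar>)
    + (\<Sum>k\<in>{1..int (Suc n) + int j}. \<bar>up_prob a n (k - 1 - int j)\<bar> * \<bar>?D (k - 1)\<bar>)"
    by (simp add: sum.distrib)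
  also have "(\<Sum>k\<in>{1..int (Suc n) + int j}. \<bar>1 - up_prob a n k\<bar> * \<bar>?D k\<bar>)
    = (\<Sum>k\<in>{1..int n + int j}. \<bar>1 - up_prob a n k\<bar> * \<bar>?D k\<bar>)"
    by (rule sum_int_extend) (auto simp: supp)
  also have "(\<Sum>k\<in>{1..int (Suc n) + int j}. \<bar>up_prob a n (k - 1 - int j)\<bar> * \<bar>?D (k - 1)\<bar>)
    = (\<Sum>k\<in>{1..int n + int j}. \<bar>up_prob a n (k - int j)\<bar> * \<bar>?D k\<bar>)"
    by (subst sum_int_shift[of "\<lambda>k. \<bar>up_prob a n (k - int j)\<bar> * \<bar>?D k\<bar>"], rule sum_int_extend)
      (auto simp: supp)
  also have "(\<Sum>k\<in>{1..int n + int j}. \<bar>1 - up_prob a n k\<bar> * \<bar>?D k\<bar>)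
      + (\<Sum>k\<in>{1..int n + int j}. \<bar>up_prob a n (k - int j)\<bar> * \<bar>?D k\<bar>)
    = (\<Sum>k\<in>{1..int n + int j}. (1 - real j * a / real n) * \<bar>?D k\<bar>)"
    unfolding sum.distrib[symmetric]
  proof (rule sum.cong)
    fix k assume k: "k \<in> {1..int n + int j}"
    have "real_of_int k \<le> real n + real j" "1 \<le> real_of_int k"
      using k by (auto simp: of_int_le_iff[of k "int n + int j", where ?'a = real, symmetric] simp del: of_int_le_iff)
    then have "a * real_of_int k \<le> a * (real n + real j)" "a * 1 \<le> a * real_of_int k"
      using assms by (auto intro!: mult_left_mono)
    then have *: "a * real_of_int k \<le> a * real n + a * real j" "a \<le> a * real_of_int k"
        "2 * (a * real j) + a * real n \<le> real n"
      using assms(4) by (simp_all add: algebra_simps)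
    \<comment> \<open>At the extreme \<open>k = n + j\<close> the numerator is
      \<open>(1 - a) * n - 2 * a * j\<close>; this is where the threshold on \<open>n\<close> comes
      from.\<close>
    have "0 \<le> (real n + a * real n - 2 * (a * real_of_int k)) / (2 * real n)"
      using * by (intro divide_nonneg_nonneg) auto
    also have "\<dots> = 1 - up_prob a n k"
      using assms by (simp add: up_prob_def field_simps)
    finally have "0 \<le> 1 - up_prob a n k" .
    moreover have "0 \<le> up_prob a n (k - int j)"
    proof -
      have "0 \<le> (real n - a * real n + 2 * (a * real_of_int k) - 2 * (a * real j)) / (2 * real n)"
        using *(2,3) assms(1) by (intro divide_nonneg_nonneg) linarith+
      also have "\<dots> = up_prob a n (k - int j)"
        using assms by (simp add: up_prob_def field_simps)
      finally show ?thesis .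
    qed
    moreover have "1 - up_prob a n k + up_prob a n (k - int j) = 1 - real j * a / real n"
      using assms by (simp add: up_prob_def field_simps)
    ultimately show "\<bar>1 - up_prob a n k\<bar> * \<bar>?D k\<bar> + \<bar>up_prob a n (k - int j)\<bar> * \<bar>?D k\<bar>
        = (1 - real j * a / real n) * \<bar>?D k\<bar>"
      by (metis abs_of_nonneg distrib_right)
  qed simp
  finally show ?thesis
    by (simp add: diff_norm_def sum_distrib_left)
qed

text \<open>The left side is nonincreasing from \<open>n0\<close> on: one step multiplies the norm
  by at most \<open>exp (- j * a / n)\<close> and the power by at most
  \<open>exp (j * a / n)\<close>. At \<open>n0\<close> itself \<open>diff_norm_le\<close>
  applies.\<close>

lemma diff_norm_decay:
  assumes a: "0 < a" "a < 1" and n: "1 \<le> n0" "n0 \<le> n" "2 * a * real j \<le> (1 - a) * real n0"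
  shows "diff_norm a j n * real n powr (j * a) \<le> 2 ^ j * real n0 powr (j * a)"
  using n(2)
proof (induction n rule: nat_induct_at_least)
  case base
  then show ?case using diff_norm_le[OF a, of n0 j] n by (intro mult_right_mono) auto
next
  case (Suc n)
  have n1: "1 \<le> n" "2 * a * real j \<le> (1 - a) * real n"
  proof -
    have "(1 - a) * real n0 \<le> (1 - a) * real n" using a Suc by (intro mult_left_mono) auto
    then show "2 * a * real j \<le> (1 - a) * real n" using n by linarith
  qed (use Suc n in auto)
  let ?c = "real j * a / real n"
  have c: "real (Suc n) powr (j * a) \<le> exp ?c * real n powr (j * a)"
  proof -
    have "ln (real (Suc n)) \<le> ln (real n) + 1 / real n"
    proof -
      have "real (Suc n) = real n * (1 + 1 / real n)"
        using n1 by (simp add: field_simps)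
      then have "ln (real (Suc n)) = ln (real n * (1 + 1 / real n))"
        by simp
      also have "\<dots> = ln (real n) + ln (1 + 1 / real n)"
        using n1 by (subst ln_mult_pos) (auto simp: add_pos_pos)
      also have "ln (1 + 1 / real n) \<le> 1 / real n"
        by (rule ln_add_one_self_le_self) simp
      finally show ?thesis by simp
    qed
    then have "real j * a * ln (real (Suc n)) \<le> real j * a * (ln (real n) + 1 / real n)"
      using a by (intro mult_left_mono) auto
    then have "exp (real j * a * ln (real (Suc n))) \<le> exp (?c + real j * a * ln (real n))"
      by (simp add: algebra_simps)
    then show ?thesis
      using n1 by (simp add: powr_def exp_add)
  qed
  have "diff_norm a j (Suc n) * real (Suc n) powr (j * a)
      \<le> ((1 - ?c) * diff_norm a j n) * real (Suc n) powr (j * a)"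
    using diff_norm_step[OF a n1] by (intro mult_right_mono) auto
  also have "\<dots> \<le> (exp (- ?c) * diff_norm a j n) * (exp ?c * real n powr (j * a))"
    using c diff_norm_nonneg[of a j n] exp_ge_add_one_self[of "- ?c"]
    by (intro mult_mono mult_right_mono) auto
  also have "\<dots> = diff_norm a j n * real n powr (j * a)"
    by (simp add: exp_minus field_simps)
  finally show ?case using Suc by linarith
qed

section \<open>Generating function of the law\<close>

text \<open>Shifting the coefficients multiplies by \<open>z\<close>, and no boundary terms appear
  because each summation range contains the whole support.\<close>

lemma bdiff_generating_function:
  fixes z :: complex
  assumes "n \<ge> 1" "z \<noteq> 0"
  shows "(\<Sum>k\<in>{1..int n + int j}. of_real ((bdiff ^^ j) (up_law a n) k) * z powi k)
    = (1 - z) ^ j * (\<Sum>k\<in>{1..int n}. of_real (up_law a n k) * z powi k)"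
proof (induction j)
  case (Suc j)
  note supp = bdiff_iter_support[OF assms(1)]
  let ?D = "(bdiff ^^ j) (up_law a n)"
  have "(\<Sum>k\<in>{1..int n + int (Suc j)}. of_real ((bdiff ^^ Suc j) (up_law a n) k) * z powi k)
    = (\<Sum>k\<in>{1..int n + int (Suc j)}. of_real (?D k) * z powi k)
      - z * (\<Sum>k\<in>{1..int n + int (Suc j)}. of_real (?D (k - 1)) * z powi (k - 1))"
    using assms(2) by (simp add: bdiff_def algebra_simps sum_subtractf sum_distrib_left power_int_diff)
  also have "(\<Sum>k\<in>{1..int n + int (Suc j)}. of_real (?D (k - 1)) * z powi (k - 1))
    = (\<Sum>k\<in>{1..int n + int j}. of_real (?D k) * z powi k)"
    by (subst sum_int_shift[of "\<lambda>k. of_real (?D k) * z powi k"], rule sum_int_extend) (auto simp: supp)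
  also have "(\<Sum>k\<in>{1..int n + int (Suc j)}. of_real (?D k) * z powi k)
    = (\<Sum>k\<in>{1..int n + int j}. of_real (?D k) * z powi k)"
    by (rule sum_int_extend) (auto simp: supp)
  finally show ?case
    unfolding Suc.IH by (simp add: algebra_simps)
qed simp

text \<open>Triangle inequality on the unit circle. It turns smoothness of the law into decay of its
  characteristic function.\<close>

lemma norm_generating_function_le:
  fixes z :: complex
  assumes "n \<ge> 1" "norm z = 1"
  shows "norm (1 - z) ^ j * norm (\<Sum>k\<in>{1..int n}. of_real (up_law a n k) * z powi k) \<le> diff_norm a j n"
proof -
  have "norm (1 - z) ^ j * norm (\<Sum>k\<in>{1..int n}. of_real (up_law a n k) * z powi k)
     = norm (\<Sum>k\<in>{1..int n + int j}. of_real ((bdiff ^^ j) (up_law a n) k) * z powi k)"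
    using assms by (subst bdiff_generating_function) (auto simp: norm_mult norm_power)
  also have "\<dots> \<le> diff_norm a j n"
    unfolding diff_norm_def using assms by (intro sum_norm_le) (simp add: norm_mult norm_power_int)
  finally show ?thesis .
qed

section \<open>The random walk\<close>

text \<open>The inputs that determine the first \<open>n\<close> steps. Step \<open>n\<close> is
  built from \<open>Memory (n - 1)\<close> and \<open>Sign (n - 1)\<close>, so the inputs with index
  \<open>n\<close> are excluded and are independent of these.\<close>

definition inputs_upto :: "nat \<Rightarrow> erw_input set" where
  "inputs_upto n = {First_Step} \<union> Memory ` {1..<n} \<union> Sign ` {1..<n}"

text \<open>The steps as functions of the inputs. The value \<open>0\<close> is returned only if the remembered time is
  out of range, which happens with probability \<open>0\<close>.\<close>

function walk_step :: "nat \<Rightarrow> (erw_input \<Rightarrow> int) \<Rightarrow> int" where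
  "walk_step n z = (if n \<le> 1 then z First_Step
     else if 1 \<le> nat (z (Memory (n - 1))) \<and> nat (z (Memory (n - 1))) < n
     then z (Sign (n - 1)) * walk_step (nat (z (Memory (n - 1)))) z else 0)"
  by auto
termination by (relation "Wellfounded.measure fst") auto

declare walk_step.simps [simp del]

lemma inputs_upto_mono: "m \<le> n \<Longrightarrow> inputs_upto m \<subseteq> inputs_upto n"
  unfolding inputs_upto_def by (intro Un_mono image_mono) auto

lemma finite_inputs_upto: "finite (inputs_upto n)"
  by (simp add: inputs_upto_def)

text \<open>Every recursive call goes to an earlier time, whose inputs are among those of time
  \<open>n\<close>.\<close>

lemma walk_step_cong:
  assumes "\<And>i. i \<in> inputs_upto n \<Longrightarrow> z i = z' i"
  shows "walk_step n z = walk_step n z'"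
  using assms
proof (induction n rule: less_induct)
  case (less n)
  show ?case
  proof (cases "n \<le> 1")
    case True
    then show ?thesis
      using less(2)[of First_Step] by (simp add: walk_step.simps inputs_upto_def)
  next
    case False
    then have eq: "z (Memory (n - 1)) = z' (Memory (n - 1))" "z (Sign (n - 1)) = z' (Sign (n - 1))"
      by (auto intro!: less(2) simp: inputs_upto_def)
    have "walk_step u z = walk_step u z'" if "u < n" for u
      using that less(1)[of u] less(2) inputs_upto_mono[of u n] by auto
    then show ?thesis
      using False eq by (subst (1 2) walk_step.simps) auto
  qed
qed

context elephant_random_walk
begin

text \<open>The family of \<open>inputs_indep\<close>, curried so that
  \<open>inputs \<omega>\<close> can be passed to \<open>walk_step\<close>.\<close>

definition inputs :: "'a \<Rightarrow> erw_input \<Rightarrow> int" where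
  "inputs \<omega> i = (case i of First_Step \<Rightarrow> X 1 \<omega> | Memory n \<Rightarrow> int (U n \<omega>) | Sign n \<Rightarrow> E n \<omega>)"

definition up_steps :: "nat \<Rightarrow> 'a \<Rightarrow> int" where
  "up_steps n \<omega> = (\<Sum>k=1..n. of_bool (X k \<omega> = 1))"

lemma inputs_simps [simp]:
  "inputs \<omega> First_Step = X 1 \<omega>" "inputs \<omega> (Memory n) = int (U n \<omega>)" "inputs \<omega> (Sign n) = E n \<omega>"
  by (simp_all add: inputs_def)

lemma indep_vars_inputs:
  "indep_vars (\<lambda>_. count_space UNIV) (\<lambda>i \<omega>. inputs \<omega> i)
     ({First_Step} \<union> Memory ` {1..} \<union> Sign ` {1..})"
  using inputs_indep unfolding inputs_def .

lemma up_steps_measurable [measurable]: "up_steps n \<in> measurable M (count_space UNIV)"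
proof (induction n)
  case 0
  then show ?case by (simp add: up_steps_def)
next
  case (Suc n)
  note [measurable] = this X_measurable[of "Suc n"]
  have "up_steps (Suc n) = (\<lambda>\<omega>. up_steps n \<omega> + of_bool (X (Suc n) \<omega> = 1))"
    by (simp add: up_steps_def fun_eq_iff)
  also have "\<dots> \<in> measurable M (count_space UNIV)" by measurable
  finally show ?case .
qed

lemma AE_U: "n \<ge> 1 \<Longrightarrow> AE \<omega> in M. U n \<omega> \<in> {1..n}"
  using AE_measure_pmf[of "pmf_of_set {1..n}"]
  by (subst (asm) U_distr[symmetric], simp, subst (asm) AE_distr_iff)
    (auto simp: U_measurable)

lemma AE_E: "n \<ge> 1 \<Longrightarrow> AE \<omega> in M. E n \<omega> \<in> {1, -1}"
proof -
  assume n: "n \<ge> 1"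
  have "AE x in measure_pmf (sign_pmf p). x \<in> {1, -1}"
    by (rule AE_pmfI) (auto simp: sign_pmf_def)
  then show ?thesis
    using n by (subst (asm) E_distr[symmetric], simp, subst (asm) AE_distr_iff)
    (auto simp: E_measurable)
qed

lemma AE_X1: "AE \<omega> in M. X 1 \<omega> \<in> {1, -1}"
proof -
  have "AE x in measure_pmf (sign_pmf q). x \<in> {1, -1}"
    by (rule AE_pmfI) (auto simp: sign_pmf_def)
  then show ?thesis
    by (subst (asm) first_step_distr[symmetric], subst (asm) AE_distr_iff)
    (auto simp: X_measurable)
qed

text \<open>Countably many null sets are collected into one. Outside it, strong induction along the
  remembered times shows that every step is +1 or -1.\<close>

lemma AE_walk:
  "AE \<omega> in M. \<forall>n\<ge>1. X n \<omega> \<in> {1, -1} \<and> U n \<omega> \<in> {1..n} \<and> E n \<omega> \<in> {1, -1} \<and>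
     X (Suc n) \<omega> = E n \<omega> * X (U n \<omega>) \<omega>"
proof -
  have "AE \<omega> in M. \<forall>n. n \<ge> 1 \<longrightarrow> U n \<omega> \<in> {1..n}" 
    by (subst AE_all_countable) (use AE_U in auto)
  moreover have "AE \<omega> in M. \<forall>n. n \<ge> 1 \<longrightarrow> E n \<omega> \<in> {1, -1}" 
    by (subst AE_all_countable) (use AE_E in auto)
  moreover have "AE \<omega> in M. \<forall>n. n \<ge> 1 \<longrightarrow> X (Suc n) \<omega> = E n \<omega> * X (U n \<omega>) \<omega>"
    by (subst AE_all_countable) (use next_step in auto)
  ultimately show ?thesis
    using AE_X1
  proof eventually_elim
    case (elim \<omega>)
    have "X n \<omega> \<in> {1, -1}" if "n \<ge> 1" for n
      using that
    proof (induction n rule: less_induct)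
      case (less n)
      show ?case
      proof (cases "n = 1")
        case False
        then obtain m where m: "n = Suc m" "m \<ge> 1" using less by (cases n) auto
        then have "U m \<omega> \<ge> 1" "U m \<omega> < n" using elim(1) by (auto simp: less_Suc_eq_le)
        then have "X (U m \<omega>) \<omega> \<in> {1, -1}" using less by auto
        then show ?thesis using elim(2,3) m by fastforce
      qed (use elim in auto)
    qed
    then show ?case using elim by blast
  qed
qed

text \<open>Turns the almost sure recursion into an explicit function of the inputs, the form to
  which their independence applies.\<close>

lemma AE_walk_step: "AE \<omega> in M. \<forall>n\<ge>1. X n \<omega> = walk_step n (inputs \<omega>)"
  using AE_walk
proof eventually_elim
  case (elim \<omega>)
  show ?case
  proof (intro allI impI)
    fix n :: nat assume "1 \<le> n"
    then show "X n \<omega> = walk_step n (inputs \<omega>)"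
    proof (induction n rule: less_induct)
      case (less n)
      show ?case
      proof (cases "n = 1")
        case True
        then show ?thesis by (simp add: walk_step.simps)
      next
        case False
        then obtain m where m: "n = Suc m" "m \<ge> 1" using less by (cases n) auto
        then have "1 \<le> U m \<omega>" "U m \<omega> < n"
          using elim by (auto simp: less_Suc_eq_le)
        then show ?thesis
          using less(1)[of "U m \<omega>"] m elim by (subst walk_step.simps) auto
      qed
    qed
  qed
qed

section \<open>Independence of the past from the next draw\<close>

text \<open>The inputs up to time \<open>n\<close> and the pair \<open>Memory n\<close>,
  \<open>Sign n\<close> are disjoint blocks of an independent family, so their restrictions are
  independent. Within the pair, independence is used a second time.\<close>

lemma prob_indep_inputs:
  assumes n: "n \<ge> 1"
    and G: "\<And>z z'. (\<And>i. i \<in> inputs_upto n \<Longrightarrow> z i = z' i) \<Longrightarrow> G z \<longleftrightarrow> G z'"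
  shows "prob {\<omega> \<in> space M. G (inputs \<omega>) \<and> U n \<omega> = u \<and> E n \<omega> = e}
    = prob {\<omega> \<in> space M. G (inputs \<omega>)} * prob {\<omega> \<in> space M. U n \<omega> = u} * prob {\<omega> \<in> space M. E n \<omega> = e}"
proof -
  let ?A = "inputs_upto n" and ?B = "{Memory n, Sign n}" and ?C = "\<lambda>_::erw_input. count_space (UNIV :: int set)"
  let ?I = "{First_Step} \<union> Memory ` {1..} \<union> Sign ` {1..}"
  define S where "S = {z \<in> ?A \<rightarrow>\<^sub>E UNIV. G z}"
  define T where "T = {z \<in> ?B \<rightarrow>\<^sub>E UNIV. z (Memory n) = int u \<and> z (Sign n) = e}"
  \<comment> \<open>A finite product of counting spaces of integers is again a counting space, so
    every set of assignments is measurable, whatever \<open>G\<close> is.\<close>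
  have sets: "S \<in> sets (PiM ?A ?C)" "T \<in> sets (PiM ?B ?C)"
    using count_space_PiM_finite[of ?A "\<lambda>_. UNIV :: int set"]
      count_space_PiM_finite[of ?B "\<lambda>_. UNIV :: int set"] finite_inputs_upto
    by (auto simp: S_def T_def)
  have "indep_var (PiM ?A ?C) (\<lambda>\<omega>. restrict (inputs \<omega>) ?A) (PiM ?B ?C) (\<lambda>\<omega>. restrict (inputs \<omega>) ?B)"
    by (rule indep_var_restrict[OF indep_vars_inputs]) (use n in \<open>auto simp: inputs_upto_def\<close>)
  from indep_varD[OF this sets]
  have "prob ((\<lambda>\<omega>. (restrict (inputs \<omega>) ?A, restrict (inputs \<omega>) ?B)) -` (S \<times> T) \<inter> space M)
    = prob ((\<lambda>\<omega>. restrict (inputs \<omega>) ?A) -` S \<inter> space M) * prob ((\<lambda>\<omega>. restrict (inputs \<omega>) ?B) -` T \<inter> space M)" .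
  moreover have "G (restrict (inputs \<omega>) ?A) \<longleftrightarrow> G (inputs \<omega>)" for \<omega>
    by (rule G) auto
  then have S: "restrict (inputs \<omega>) ?A \<in> S \<longleftrightarrow> G (inputs \<omega>)" for \<omega>
    by (auto simp: S_def)
  have T: "restrict (inputs \<omega>) ?B \<in> T \<longleftrightarrow> U n \<omega> = u \<and> E n \<omega> = e" for \<omega>
    by (auto simp: T_def)
  have "prob ((\<lambda>\<omega>. restrict (inputs \<omega>) ?B) -` T \<inter> space M)
      = prob (\<Inter>j\<in>?B. (\<lambda>\<omega>. inputs \<omega> j) -` (if j = Memory n then {int u} else {e}) \<inter> space M)"
    by (rule arg_cong[where f = prob]) (auto simp: T)
  also have "\<dots> = (\<Prod>j\<in>?B. prob ((\<lambda>\<omega>. inputs \<omega> j) -` (if j = Memory n then {int u} else {e}) \<inter> space M))"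
    by (rule indep_varsD[OF indep_vars_inputs]) (use n in auto)
  also have "\<dots> = prob {\<omega> \<in> space M. U n \<omega> = u} * prob {\<omega> \<in> space M. E n \<omega> = e}"
    by (simp add: vimage_def Int_def conj_commute)
  moreover have "(\<lambda>\<omega>. (restrict (inputs \<omega>) ?A, restrict (inputs \<omega>) ?B)) -` (S \<times> T) \<inter> space M
     = {\<omega> \<in> space M. G (inputs \<omega>) \<and> U n \<omega> = u \<and> E n \<omega> = e}"
    using S T by auto
  moreover have "(\<lambda>\<omega>. restrict (inputs \<omega>) ?A) -` S \<inter> space M = {\<omega> \<in> space M. G (inputs \<omega>)}"
    using S by auto
  ultimately show ?thesis by (simp only: mult.assoc)
qed

lemma prob_U: "n \<ge> 1 \<Longrightarrow> u \<in> {1..n} \<Longrightarrow> prob {\<omega> \<in> space M. U n \<omega> = u} = 1 / real n"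
proof -
  assume n: "n \<ge> 1" and u: "u \<in> {1..n}"
  have "prob {\<omega> \<in> space M. U n \<omega> = u} = measure (distr M (count_space UNIV) (U n)) {u}"
    using n by (subst measure_distr) (auto simp: U_measurable vimage_def Int_def conj_commute)
  also have "\<dots> = 1 / real n"
    using n u by (simp add: U_distr measure_pmf_single)
  finally show ?thesis .
qed

lemma prob_E: "n \<ge> 1 \<Longrightarrow> prob {\<omega> \<in> space M. E n \<omega> = 1} = p"
  "n \<ge> 1 \<Longrightarrow> prob {\<omega> \<in> space M. E n \<omega> = -1} = 1 - p"
proof -
  assume n: "n \<ge> 1"
  have *: "prob {\<omega> \<in> space M. E n \<omega> = e} = pmf (sign_pmf p) e" for e
    using n measure_distr[of "E n" M "count_space UNIV" "{e}"]
    by (simp add: E_distr E_measurable vimage_def Int_def conj_commute measure_pmf_single)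
  have inj: "inj (\<lambda>b. if b then 1 else - 1 :: int)" by (auto simp: inj_on_def)
  show "prob {\<omega> \<in> space M. E n \<omega> = 1} = p" "prob {\<omega> \<in> space M. E n \<omega> = -1} = 1 - p"
    using pmf_map_inj'[OF inj, of "bernoulli_pmf p" True] pmf_map_inj'[OF inj, of "bernoulli_pmf p" False] p_range
    by (simp_all add: * sign_pmf_def)
qed

text \<open>Up to a null set, the event about the past is a condition \<open>G\<close> on the inputs
  up to time \<open>n\<close>, to which \<open>prob_indep_inputs\<close> applies.\<close>

lemma prob_walk_indep:
  assumes n: "n \<ge> 1" and u: "u \<in> {1..n}"
  shows "prob {\<omega> \<in> space M. (up_steps n \<omega> = k \<and> X u \<omega> = c) \<and> U n \<omega> = u \<and> E n \<omega> = e}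
    = prob {\<omega> \<in> space M. up_steps n \<omega> = k \<and> X u \<omega> = c} * (1 / real n) * prob {\<omega> \<in> space M. E n \<omega> = e}"
proof -
  have "1 \<le> u" using u by simp
  note [measurable] = X_measurable[OF this] U_measurable[OF n] E_measurable[OF n]
  define G where "G z \<longleftrightarrow> (\<Sum>k=1..n. of_bool (walk_step k z = 1)) = k \<and> walk_step u z = c" for z
  have G: "G z \<longleftrightarrow> G z'" if *: "\<And>i. i \<in> inputs_upto n \<Longrightarrow> z i = z' i" for z z'
  proof -
    have "walk_step j z = walk_step j z'" if "j \<le> n" for j
      using inputs_upto_mono[OF that] * by (intro walk_step_cong) auto
    then show ?thesis using u by (simp add: G_def)
  qed
  have AE: "AE \<omega> in M. (up_steps n \<omega> = k \<and> X u \<omega> = c) \<longleftrightarrow> G (inputs \<omega>)"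
    using AE_walk_step by eventually_elim (use u in \<open>simp add: G_def up_steps_def\<close>)
  \<comment> \<open>The event is the preimage of a set in a discrete space under the restriction to
    finitely many inputs.\<close>
  have meas: "{\<omega> \<in> space M. G (inputs \<omega>)} \<in> events"
  proof -
    have "(\<lambda>\<omega>. restrict (inputs \<omega>) (inputs_upto n)) \<in> measurable M (PiM (inputs_upto n) (\<lambda>_. count_space UNIV))"
      using indep_vars_inputs unfolding indep_vars_def
      by (intro measurable_restrict) (auto simp: inputs_upto_def)
    moreover have "PiM (inputs_upto n) (\<lambda>_. count_space UNIV) = count_space (inputs_upto n \<rightarrow>\<^sub>E (UNIV :: int set))"
      by (rule count_space_PiM_finite) (auto simp: finite_inputs_upto)
    moreover have "{z \<in> inputs_upto n \<rightarrow>\<^sub>E (UNIV :: int set). G z} \<in> sets (count_space (inputs_upto n \<rightarrow>\<^sub>E (UNIV :: int set)))"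
      by auto
    ultimately have "(\<lambda>\<omega>. restrict (inputs \<omega>) (inputs_upto n)) -` {z \<in> inputs_upto n \<rightarrow>\<^sub>E UNIV. G z} \<inter> space M \<in> events"
      by (metis (no_types, lifting) measurable_sets)
    also have "(\<lambda>\<omega>. restrict (inputs \<omega>) (inputs_upto n)) -` {z \<in> inputs_upto n \<rightarrow>\<^sub>E UNIV. G z} \<inter> space M
      = {\<omega> \<in> space M. G (inputs \<omega>)}"
      using G[of "restrict (inputs _) (inputs_upto n)" "inputs _"] by auto
    finally show ?thesis .
  qed
  have "prob {\<omega> \<in> space M. (up_steps n \<omega> = k \<and> X u \<omega> = c) \<and> U n \<omega> = u \<and> E n \<omega> = e}
      = prob {\<omega> \<in> space M. G (inputs \<omega>) \<and> U n \<omega> = u \<and> E n \<omega> = e}"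
  proof (rule finite_measure_eq_AE)
    show "AE \<omega> in M. \<omega> \<in> {\<omega> \<in> space M. (up_steps n \<omega> = k \<and> X u \<omega> = c) \<and> U n \<omega> = u \<and> E n \<omega> = e}
      \<longleftrightarrow> \<omega> \<in> {\<omega> \<in> space M. G (inputs \<omega>) \<and> U n \<omega> = u \<and> E n \<omega> = e}"
      using AE by eventually_elim auto
    show "{\<omega> \<in> space M. (up_steps n \<omega> = k \<and> X u \<omega> = c) \<and> U n \<omega> = u \<and> E n \<omega> = e} \<in> events"
      by measurable
    have "{\<omega> \<in> space M. G (inputs \<omega>) \<and> U n \<omega> = u \<and> E n \<omega> = e}
      = {\<omega> \<in> space M. G (inputs \<omega>)} \<inter> {\<omega> \<in> space M. U n \<omega> = u \<and> E n \<omega> = e}" by auto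
    also have "\<dots> \<in> events" using meas by (rule sets.Int) measurable
    finally show "{\<omega> \<in> space M. G (inputs \<omega>) \<and> U n \<omega> = u \<and> E n \<omega> = e} \<in> events" .
  qed
  also have "\<dots> = prob {\<omega> \<in> space M. G (inputs \<omega>)} * prob {\<omega> \<in> space M. U n \<omega> = u} * prob {\<omega> \<in> space M. E n \<omega> = e}"
    by (rule prob_indep_inputs[OF n G])
  also have "prob {\<omega> \<in> space M. G (inputs \<omega>)} = prob {\<omega> \<in> space M. up_steps n \<omega> = k \<and> X u \<omega> = c}"
  proof (rule finite_measure_eq_AE)
    show "AE \<omega> in M. \<omega> \<in> {\<omega> \<in> space M. G (inputs \<omega>)} \<longleftrightarrow> \<omega> \<in> {\<omega> \<in> space M. up_steps n \<omega> = k \<and> X u \<omega> = c}"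
      using AE by eventually_elim auto
  qed (use meas in measurable)
  also have "prob {\<omega> \<in> space M. U n \<omega> = u} = 1 / real n"
    using n u by (rule prob_U)
  finally show ?thesis .
qed


text \<open>A product of two signs is 1 iff they agree, so the event splits according to the
  remembered time \<open>u\<close> and the common sign \<open>e\<close> of \<open>X u\<close> and
  \<open>E n\<close>. Summing over \<open>u\<close> then counts the positive and the negative steps
  so far.\<close>

lemma prob_up_step:
  assumes n: "n \<ge> 1"
  shows "prob {\<omega> \<in> space M. up_steps n \<omega> = k \<and> X (Suc n) \<omega> = 1}
    = up_prob (2 * p - 1) n k * prob {\<omega> \<in> space M. up_steps n \<omega> = k}"
proof -
  note [measurable] = X_measurable[of "Suc n", simplified] U_measurable[OF n] E_measurable[OF n]
  define K where "K = {\<omega> \<in> space M. up_steps n \<omega> = k}"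
  define A where "A = {\<omega> \<in> space M. up_steps n \<omega> = k \<and> X (Suc n) \<omega> = 1}"
  define B where "B u e = {\<omega> \<in> space M. (up_steps n \<omega> = k \<and> X u \<omega> = e) \<and> U n \<omega> = u \<and> E n \<omega> = e}" for u e
  define C where "C u e = {\<omega> \<in> space M. up_steps n \<omega> = k \<and> X u \<omega> = e}" for u e
  have [measurable]: "A \<in> events" unfolding A_def by measurable
  have [measurable]: "K \<in> events" unfolding K_def by measurable
  have [measurable]: "B u e \<in> events" "C u e \<in> events" if "u \<in> {1..n}" for u e 
  proof -
    have "1 \<le> u" using that by simp
    note [measurable] = X_measurable[OF this]
    show "B u e \<in> events" "C u e \<in> events"
      unfolding B_def C_def by measurable
  qed
  have integrable_BC: "integrable M (indicat_real (B u e))" "integrable M (indicat_real (C u e))"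
    if "u \<in> {1..n}" for u e
    using that by (intro integrable_real_indicator; simp add: emeasure_eq_measure)+
  \<comment> \<open>Linearity of expectation: on \<open>K\<close> exactly \<open>k\<close> indices
    \<open>u\<close> have a positive step and, almost surely, \<open>n - k\<close> a negative
    one.\<close>
  have count: "(\<Sum>u=1..n. prob (C u 1)) = real_of_int k * prob K"
    "(\<Sum>u=1..n. prob (C u (-1))) = (real n - real_of_int k) * prob K"
  proof -
    have *: "(\<Sum>u=1..n. prob (C u e)) = (\<integral>\<omega>. (\<Sum>u=1..n. indicator (C u e) \<omega>) \<partial>M)" for e
      by (subst Bochner_Integration.integral_sum) (auto simp: integrable_BC)
    have ind: "(\<Sum>u=1..n. indicator (C u e) \<omega> :: real) = (\<Sum>u=1..n. of_bool (X u \<omega> = e)) * indicator K \<omega>"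
      if "\<omega> \<in> space M" for e \<omega>
      using that by (auto simp: C_def K_def indicator_def sum_distrib_right intro!: sum.cong)
    have "(\<Sum>u=1..n. prob (C u 1)) = (\<integral>\<omega>. real_of_int k * indicator K \<omega> \<partial>M)"
      unfolding * 
    proof (rule Bochner_Integration.integral_cong)
      fix \<omega> assume "\<omega> \<in> space M"
      moreover have "(\<Sum>u=1..n. of_bool (X u \<omega> = 1)) = real_of_int (up_steps n \<omega>)"
        by (simp add: up_steps_def)
      ultimately show "(\<Sum>u=1..n. indicator (C u 1) \<omega>) = real_of_int k * indicator K \<omega>"
        by (subst ind) (auto simp: K_def indicator_def)
    qed simp
    then show "(\<Sum>u=1..n. prob (C u 1)) = real_of_int k * prob K" by simp
    have "(\<Sum>u=1..n. prob (C u (-1))) = (\<integral>\<omega>. (real n - real_of_int k) * indicator K \<omega> \<partial>M)"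
      unfolding * 
    proof (rule integral_cong_AE)
      show "AE \<omega> in M. (\<Sum>u=1..n. indicator (C u (-1)) \<omega>) = (real n - real_of_int k) * indicator K \<omega>"
        using AE_walk AE_space
      proof eventually_elim
        case (elim \<omega>)
        have "(\<Sum>u=1..n. of_bool (X u \<omega> = -1)) = (\<Sum>u=1..n. 1 - of_bool (X u \<omega> = 1) :: real)"
          using elim(1) by (intro sum.cong) auto
        also have "\<dots> = real n - real_of_int (up_steps n \<omega>)"
          by (simp add: up_steps_def sum_subtractf)
        finally show ?case
          using elim(2) by (subst ind) (auto simp: K_def indicator_def)
      qed
    qed measurable
    then show "(\<Sum>u=1..n. prob (C u (-1))) = (real n - real_of_int k) * prob K" by simp
  qed
  have "prob A = (\<integral>\<omega>. indicator A \<omega> \<partial>M)" by simp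
  also have "\<dots> = (\<integral>\<omega>. (\<Sum>u=1..n. indicator (B u 1) \<omega> + indicator (B u (-1)) \<omega>) \<partial>M)"
  proof (rule integral_cong_AE)
    show "AE \<omega> in M. (indicator A \<omega> :: real) = (\<Sum>u=1..n. indicator (B u 1) \<omega> + indicator (B u (-1)) \<omega>)"
      using AE_walk AE_space
    proof eventually_elim
      case (elim \<omega>)
      then have e: "U n \<omega> \<in> {1..n}" "E n \<omega> \<in> {1, -1}" "X (Suc n) \<omega> = E n \<omega> * X (U n \<omega>) \<omega>"
        "X (U n \<omega>) \<omega> \<in> {1, -1}"
        using n by auto
      \<comment> \<open>Only \<open>u = U n \<omega>\<close> with the sign
        \<open>E n \<omega>\<close> can contribute.\<close>
      have "(\<Sum>u=1..n. indicator (B u 1) \<omega> + indicator (B u (-1)) \<omega> :: real)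
        = (\<Sum>u=1..n. if u = U n \<omega> then indicator A \<omega> else 0)"
        using e elim(2) by (intro sum.cong) (auto simp: B_def A_def indicator_def)
      also have "\<dots> = indicator A \<omega>"
        using e(1) by simp
      finally show ?case ..
    qed
  qed measurable
  also have "\<dots> = (\<Sum>u=1..n. prob (B u 1) + prob (B u (-1)))"
    by (subst Bochner_Integration.integral_sum) (auto simp: integrable_BC)
  also have "\<dots> = (\<Sum>u=1..n. prob (C u 1) * (p / real n) + prob (C u (-1)) * ((1 - p) / real n))"
  proof (rule sum.cong[OF refl])
    fix u assume u: "u \<in> {1..n}"
    show "prob (B u 1) + prob (B u (-1)) = prob (C u 1) * (p / real n) + prob (C u (-1)) * ((1 - p) / real n)"
      unfolding B_def C_def prob_walk_indep[OF n u] prob_E[OF n] by simp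
  qed
  also have "\<dots> = (real_of_int k * prob K) * (p / real n) + ((real n - real_of_int k) * prob K) * ((1 - p) / real n)"
    unfolding sum.distrib sum_distrib_right[symmetric] count ..
  also have "\<dots> = up_prob (2 * p - 1) n k * prob K"
    using n by (simp add: up_prob_def field_simps)
  finally show ?thesis by (simp add: A_def K_def)
qed

text \<open>A count of \<open>k\<close> at time \<open>n + 1\<close> arises from \<open>k\<close>
  without, or from \<open>k - 1\<close> with, a further positive step. The choice
  \<open>q = 1\<close> fixes the start.\<close>

lemma prob_up_steps:
  assumes "q = 1" "n \<ge> 1"
  shows "prob {\<omega> \<in> space M. up_steps n \<omega> = k} = up_law (2 * p - 1) n k"
  using assms(2)
proof (induction n arbitrary: k rule: nat_induct_at_least)
  case base
  note [measurable] = X_measurable[of 1, simplified]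
  have "prob {\<omega> \<in> space M. X 1 \<omega> = 1} = measure (distr M (count_space UNIV) (X 1)) {1}"
    by (subst measure_distr) (auto simp: X_measurable vimage_def Int_def conj_commute)
  also have "\<dots> = pmf (sign_pmf q) 1"
    by (simp add: first_step_distr measure_pmf_single del: One_nat_def)
  also have "\<dots> = 1"
    using pmf_map_inj'[of "\<lambda>b. if b then 1 else - 1 :: int" "bernoulli_pmf q" True] assms
    by (auto simp: sign_pmf_def inj_on_def)
  finally have X1: "AE \<omega> in M. X 1 \<omega> = 1"
    by (subst (asm) prob_Collect_eq_1) auto
  have "prob {\<omega> \<in> space M. up_steps 1 \<omega> = k} = prob {\<omega> \<in> space M. 1 = k}"
  proof (rule finite_measure_eq_AE)
    show "AE \<omega> in M. \<omega> \<in> {\<omega> \<in> space M. up_steps 1 \<omega> = k} \<longleftrightarrow> \<omega> \<in> {\<omega> \<in> space M. 1 = k}"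
      using X1 by eventually_elim (simp add: up_steps_def)
  qed measurable
  then show ?case by (auto simp: up_law.simps prob_space)
next
  case (Suc n)
  note [measurable] = X_measurable[of "Suc n", simplified]
  have "prob {\<omega> \<in> space M. up_steps (Suc n) \<omega> = k}
     = prob ({\<omega> \<in> space M. up_steps n \<omega> = k} - {\<omega> \<in> space M. up_steps n \<omega> = k \<and> X (Suc n) \<omega> = 1}
        \<union> {\<omega> \<in> space M. up_steps n \<omega> = k - 1 \<and> X (Suc n) \<omega> = 1})"
    by (rule arg_cong[where f = prob]) (auto simp: up_steps_def)
  also have "\<dots> = prob ({\<omega> \<in> space M. up_steps n \<omega> = k} - {\<omega> \<in> space M. up_steps n \<omega> = k \<and> X (Suc n) \<omega> = 1})
     + prob {\<omega> \<in> space M. up_steps n \<omega> = k - 1 \<and> X (Suc n) \<omega> = 1}"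
    by (rule finite_measure_Union) auto
  also have "prob ({\<omega> \<in> space M. up_steps n \<omega> = k} - {\<omega> \<in> space M. up_steps n \<omega> = k \<and> X (Suc n) \<omega> = 1})
     = prob {\<omega> \<in> space M. up_steps n \<omega> = k} - prob {\<omega> \<in> space M. up_steps n \<omega> = k \<and> X (Suc n) \<omega> = 1}"
    by (rule finite_measure_Diff) auto
  finally show ?case
    unfolding prob_up_step[OF Suc(1)] Suc.IH using Suc(1) by (simp add: up_law_step algebra_simps)
qed

lemma AE_walk_position: "AE \<omega> in M. \<forall>n. walk_position X n \<omega> = 2 * up_steps n \<omega> - int n"
  using AE_walk
proof eventually_elim
  case (elim \<omega>)
  have "walk_position X n \<omega> = (\<Sum>k=1..n. 2 * of_bool (X k \<omega> = 1) - 1)" for n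
    unfolding walk_position_def using elim by (intro sum.cong) auto
  then show ?case
    by (simp add: up_steps_def sum_subtractf sum_distrib_left)
qed

lemma AE_up_steps_range: "AE \<omega> in M. up_steps n \<omega> \<in> {0..int n}"
proof (rule AE_I2)
  fix \<omega>
  have "up_steps n \<omega> \<le> (\<Sum>k=1..n. 1)"
    unfolding up_steps_def by (rule sum_mono) auto
  then show "up_steps n \<omega> \<in> {0..int n}"
    by (auto simp: up_steps_def intro!: sum_nonneg)
qed

end

section \<open>Densities from characteristic functions\<close>

text \<open>The Fourier inversion formula for a density; the real part makes it real-valued by
  construction.\<close>

definition inv_char :: "real measure \<Rightarrow> real \<Rightarrow> real" where
  "inv_char \<mu> x = Re (\<integral>t. iexp (- (t * x)) * char \<mu> t \<partial>lborel) / (2 * pi)"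

lemma iexp_integral:
  fixes a b t :: real
  assumes "a \<le> b" "t \<noteq> 0"
  shows "(\<integral>x. indicator {a..b} x *\<^sub>R iexp (- (t * x)) \<partial>lborel)
    = (iexp (- (t * a)) - iexp (- (t * b))) / (\<i> * t)"
proof -
  have "(\<integral>x. indicator {a..b} x *\<^sub>R iexp (- (t * x)) \<partial>lborel)
     = - iexp (- (t * b)) / (\<i> * t) - (- iexp (- (t * a)) / (\<i> * t))"
  proof (rule integral_FTC_Icc[OF assms(1)])
    fix x
    have "((\<lambda>z. - exp (\<i> * - (of_real t * z)) / (\<i> * t)) has_field_derivative exp (\<i> * - (of_real t * of_real x)))
       (at (of_real x))"
      using assms(2) by (auto intro!: derivative_eq_intros simp: mult_ac)
    from has_vector_derivative_real_field[OF this]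
    show "((\<lambda>x. - iexp (- (t * x)) / (\<i> * t)) has_vector_derivative iexp (- (t * x))) (at x within {a..b})"
      by (simp add: has_vector_derivative_at_within)
  qed (auto intro!: continuous_intros)
  then show ?thesis by (simp add: diff_divide_distrib)
qed

context real_distribution
begin

context
  assumes char_int: "integrable lborel (char M)"
begin

lemma inv_char_bounded: "\<bar>inv_char M x\<bar> \<le> (\<integral>t. norm (char M t) \<partial>lborel)"
proof -
  have "\<bar>inv_char M x\<bar> \<le> norm (\<integral>t. iexp (- (t * x)) * char M t \<partial>lborel) / (2 * pi)"
    unfolding inv_char_def by (simp add: abs_Re_le_cmod divide_right_mono)
  also have "\<dots> \<le> (\<integral>t. norm (iexp (- (t * x)) * char M t) \<partial>lborel) / (2 * pi)"
    by (intro divide_right_mono integral_norm_bound) auto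
  also have "\<dots> = (\<integral>t. norm (char M t) \<partial>lborel) / (2 * pi)"
    by (simp add: norm_mult)
  also have "\<dots> \<le> (\<integral>t. norm (char M t) \<partial>lborel) / 1"
    using pi_gt3 by (intro divide_left_mono) auto
  finally show ?thesis by simp
qed

lemma continuous_inv_char: "continuous_on A (inv_char M)"
proof (rule continuous_at_imp_continuous_on, safe)
  fix x
  have "isCont (\<lambda>x. \<integral>t. iexp (- (t * x)) * char M t \<partial>lborel) x"
    unfolding continuous_at_sequentially
  proof safe
    fix X assume X: "X \<longlonglongrightarrow> x"
    show "((\<lambda>x. \<integral>t. iexp (- (t * x)) * char M t \<partial>lborel) \<circ> X) \<longlonglongrightarrow> (\<integral>t. iexp (- (t * x)) * char M t \<partial>lborel)"
      unfolding comp_def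
      by (rule integral_dominated_convergence[where w="\<lambda>t. norm (char M t)"])
        (auto intro!: tendsto_intros X simp: char_int norm_mult)
  qed
  then show "isCont (inv_char M) x"
    unfolding inv_char_def by (intro continuous_intros) auto
qed

lemma inv_char_measurable [measurable]: "inv_char M \<in> borel_measurable borel"
  by (intro borel_measurable_continuous_onI continuous_inv_char)

lemma inv_char_integrable_Icc: "integrable lborel (\<lambda>x. indicator {a..b} x * inv_char M x)"
  using borel_integrable_compact[of "{a..b}" "inv_char M"] continuous_inv_char
  by (simp add: set_integrable_def)

text \<open>Levy's inversion formula, whose endpoint conditions appear here, gives the mass as a
  limit of truncated integrals of \<open>G\<close>. Integrability of \<open>char M\<close> removes
  the truncation, and Fubini moves the integral over \<open>{a..b}\<close> hidden in the kernel to
  the outside.\<close>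

lemma measure_Ioc_eq_inv_char_aux:
  assumes "a \<le> b" "prob {a} = 0" "prob {b} = 0"
  shows "prob {a<..b} = (\<integral>x. indicator {a..b} x * inv_char M x \<partial>lborel)"
proof -
  define G where "G t = (iexp (- (t * a)) - iexp (- (t * b))) / (\<i> * t) * char M t" for t :: real
  define h where "h t x = indicator {a..b} x *\<^sub>R (iexp (- (t * x)) * char M t)" for t x :: real
  have meas: "case_prod h \<in> borel_measurable (lborel \<Otimes>\<^sub>M lborel)"
    unfolding h_def by measurable
  have norm_h: "norm (h t x) = norm (char M t) * indicator {a..b} x" for t x
    by (simp add: h_def norm_mult)
  have h_int: "integrable (lborel \<Otimes>\<^sub>M lborel) (case_prod h)"
  proof (rule lborel_pair.Fubini_integrable[OF meas])
    show "integrable lborel (\<lambda>t. \<integral>x. norm (case (t, x) of (t, x) \<Rightarrow> h t x) \<partial>lborel)"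
      using char_int by (simp add: norm_h)
    show "AE t in lborel. integrable lborel (\<lambda>x. case (t, x) of (t, x) \<Rightarrow> h t x)"
    proof (rule AE_I2)
      fix t
      have "integrable lborel (\<lambda>x. indicator {a..b} x *\<^sub>R (iexp (- (t * x)) * char M t))"
        by (rule borel_integrable_compact) (auto intro!: continuous_intros)
      then show "integrable lborel (\<lambda>x. case (t, x) of (t, x) \<Rightarrow> h t x)" by (simp add: h_def)
    qed
  qed
  \<comment> \<open>The closed form of the kernel divides by \<open>t\<close>, so it is used off the
    null set \<open>{0}\<close>.\<close>
  have G: "AE t in lborel. (\<integral>x. h t x \<partial>lborel) = G t"
  proof -
    have "AE t in lborel. t \<noteq> (0::real)" by (rule AE_lborel_singleton)
    then show ?thesis
    proof eventually_elim
      case (elim t)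
      have "(\<integral>x. h t x \<partial>lborel) = (\<integral>x. (indicator {a..b} x *\<^sub>R iexp (- (t * x))) * char M t \<partial>lborel)"
        by (simp add: h_def)
      also have "\<dots> = (\<integral>x. indicator {a..b} x *\<^sub>R iexp (- (t * x)) \<partial>lborel) * char M t"
        by (rule integral_mult_left_zero)
      also have "\<dots> = G t"
        unfolding G_def iexp_integral[OF assms(1) elim] ..
      finally show ?case .
    qed
  qed
  have G_meas [measurable]: "G \<in> borel_measurable borel"
    unfolding G_def by measurable
  have h_fst: "integrable lborel (\<lambda>t. \<integral>x. h t x \<partial>lborel)"
    using lborel_pair.integrable_fst[OF h_int] by simp
  have [measurable]: "(\<lambda>t. \<integral>x. h t x \<partial>lborel) \<in> borel_measurable lborel"
    by (rule borel_measurable_integrable[OF h_fst])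
  have G_int: "integrable lborel G"
    using h_fst by (subst (asm) integrable_cong_AE[OF _ _ G]) auto
  have "(\<lambda>T. CLBINT t=- real T..real T. G t) \<longlonglongrightarrow> (\<integral>t. G t \<partial>lborel)"
  proof -
    have "(\<lambda>T. \<integral>t. indicator {- real T<..<real T} t *\<^sub>R G t \<partial>lborel) \<longlonglongrightarrow> (\<integral>t. G t \<partial>lborel)"
    proof (rule integral_dominated_convergence[where w="\<lambda>t. norm (G t)"])
      show "AE t in lborel. (\<lambda>T. indicator {- real T<..<real T} t *\<^sub>R G t) \<longlonglongrightarrow> G t"
      proof (rule AE_I2)
        fix t :: real
        have "eventually (\<lambda>T. t \<in> {- real T<..<real T}) sequentially"
          using filterlim_real_sequentially[unfolded filterlim_at_top_dense, rule_format, of "\<bar>t\<bar>"]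
          by eventually_elim (auto simp: abs_less_iff)
        then have "eventually (\<lambda>T. indicator {- real T<..<real T} t *\<^sub>R G t = G t) sequentially"
          by eventually_elim simp
        then show "(\<lambda>T. indicator {- real T<..<real T} t *\<^sub>R G t) \<longlonglongrightarrow> G t"
          by (rule tendsto_eventually)
      qed
    qed (use G_int in \<open>auto simp: indicator_def\<close>)
    moreover have "(CLBINT t=- real T..real T. G t) = (\<integral>t. indicator {- real T<..<real T} t *\<^sub>R G t \<partial>lborel)" for T
      by (simp add: interval_lebesgue_integral_def set_lebesgue_integral_def)
    ultimately show ?thesis by simp
  qed
  then have "(\<lambda>T. 1 / (2 * pi) * (CLBINT t=- real T..real T. G t)) \<longlonglongrightarrow> 1 / (2 * pi) * (\<integral>t. G t \<partial>lborel)"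
    by (intro tendsto_mult tendsto_const)
  moreover have "(\<lambda>T. 1 / (2 * pi) * (CLBINT t=- real T..real T. G t)) \<longlonglongrightarrow> prob {a<..b}"
    using Levy_Inversion[OF assms] unfolding G_def of_int_minus of_int_of_nat_eq .
  ultimately have "of_real (prob {a<..b}) = 1 / (2 * pi) * (\<integral>t. G t \<partial>lborel)"
    using LIMSEQ_unique by blast
  also have "(\<integral>t. G t \<partial>lborel) = (\<integral>t. (\<integral>x. h t x \<partial>lborel) \<partial>lborel)"
    by (rule integral_cong_AE) (use G in \<open>auto elim!: eventually_mono\<close>)
  also have "\<dots> = (\<integral>x. (\<integral>t. h t x \<partial>lborel) \<partial>lborel)"
    by (rule lborel_pair.Fubini_integral[OF h_int, symmetric])
  finally have "prob {a<..b} = Re (1 / (2 * pi) * (\<integral>x. (\<integral>t. h t x \<partial>lborel) \<partial>lborel))"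
    by (metis Re_complex_of_real)
  also have "\<dots> = Re (\<integral>x. (\<integral>t. h t x \<partial>lborel) \<partial>lborel) / (2 * pi)"
    by (simp only: times_complex.sel Re_complex_of_real Im_complex_of_real) simp
  also have "\<dots> = (\<integral>x. Re (\<integral>t. h t x \<partial>lborel) \<partial>lborel) / (2 * pi)"
    using lborel_pair.integrable_snd[OF h_int] by simp
  also have "\<dots> = (\<integral>x. indicator {a..b} x * inv_char M x \<partial>lborel)"
    by (simp add: h_def inv_char_def flip: integral_divide_zero)
  finally show ?thesis .
qed

lemma inv_char_integral_Icc_le:
  assumes "a \<le> b"
  shows "(\<integral>x. indicator {a..b} x * inv_char M x \<partial>lborel) \<le> (\<integral>t. norm (char M t) \<partial>lborel) * (b - a)"
proof -
  have "(\<integral>x. indicator {a..b} x * inv_char M x \<partial>lborel)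
      \<le> (\<integral>x. indicator {a..b} x * (\<integral>t. norm (char M t) \<partial>lborel) \<partial>lborel)"
  proof (rule integral_mono[OF inv_char_integrable_Icc])
    fix x
    show "indicator {a..b} x * inv_char M x \<le> indicator {a..b} x * (\<integral>t. norm (char M t) \<partial>lborel)"
      using inv_char_bounded[of x] by (intro mult_left_mono) auto
  qed (intro integrable_mult_left integrable_real_indicator; simp add: emeasure_lborel_Icc_eq)
  then show ?thesis using assms by (simp add: mult.commute)
qed

text \<open>There are only countably many atoms, so \<open>x\<close> lies in arbitrarily short
  intervals with massless endpoints, whose mass is at most a constant times their length.\<close>

lemma prob_singleton_eq_0: "prob {x} = 0"
proof -
  define C where "C = (\<integral>t. norm (char M t) \<partial>lborel)"
  have C: "0 \<le> C" by (simp add: C_def)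
  have "prob {x} \<le> 0 + e" if e: "e > 0" for e
  proof -
    \<comment> \<open>The enclosing interval is shorter than \<open>2 * d\<close>, so its mass is at
      most \<open>C * (2 * d) \<le> e\<close>; the summand 1 covers \<open>C = 0\<close>.\<close>
    define d where "d = e / (2 * (C + 1))"
    have d: "d > 0" using e C by (simp add: d_def)
    obtain a where a: "x - d < a" "a < x" "prob {a} = 0"
      using open_minus_countable[OF countable_support, of "{x - d<..<x}"] d by auto
    obtain b where b: "x < b" "b < x + d" "prob {b} = 0"
      using open_minus_countable[OF countable_support, of "{x<..<x + d}"] d by auto
    have "prob {x} \<le> prob {a<..b}"
      using a b by (intro finite_measure_mono) auto
    also have "\<dots> \<le> C * (b - a)"
      using a b inv_char_integral_Icc_le[of a b] measure_Ioc_eq_inv_char_aux[of a b] 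
      by (simp add: C_def)
    also have "\<dots> \<le> C * (2 * d)"
      using a b C by (intro mult_left_mono) auto
    also have "\<dots> \<le> e"
      using e C by (simp add: d_def field_simps)
    finally show ?thesis by simp
  qed
  then have "prob {x} \<le> 0" by (rule field_le_epsilon)
  then show ?thesis by (simp add: measure_le_0_iff)
qed

lemma measure_Ioc_eq_inv_char:
  "a \<le> b \<Longrightarrow> prob {a<..b} = (\<integral>x. indicator {a..b} x * inv_char M x \<partial>lborel)"
  by (rule measure_Ioc_eq_inv_char_aux) (auto simp: prob_singleton_eq_0)

text \<open>Fundamental theorem of calculus with increments \<open>1 / (n + 1)\<close>. It recovers
  \<open>inv_char\<close> pointwise from interval masses, which is how nonnegativity and
  quasi-concavity reach it.\<close>

lemma inv_char_eq_limit:
  "(\<lambda>n. prob {x<..x + inverse (real (Suc n))} * real (Suc n)) \<longlonglongrightarrow> inv_char M x"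
proof -
  have Ioc: "prob {x<..y} = integral {x..y} (inv_char M)" if "x \<le> y" for y
    using that set_borel_integral_eq_integral(2)[of "{x..y}" "inv_char M"] inv_char_integrable_Icc
    by (simp add: measure_Ioc_eq_inv_char set_integrable_def set_lebesgue_integral_def)
  have "((\<lambda>y. integral {x..y} (inv_char M)) has_real_derivative inv_char M x) (at x within {x..x+1})"
    by (rule integral_has_real_derivative) (auto intro: continuous_inv_char)
  then have lim: "((\<lambda>y. integral {x..y} (inv_char M) / (y - x)) \<longlongrightarrow> inv_char M x) (at x within {x..x+1})"
    by (simp add: has_field_derivative_iff)
  have "(\<lambda>n. integral {x..x + inverse (real (Suc n))} (inv_char M) / (x + inverse (real (Suc n)) - x))
     \<longlonglongrightarrow> inv_char M x"
  proof (rule filterlim_compose[OF lim])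
    show "filterlim (\<lambda>n. x + inverse (real (Suc n))) (at x within {x..x + 1}) sequentially"
      unfolding filterlim_at
    proof
      show "(\<lambda>n. x + inverse (real (Suc n))) \<longlonglongrightarrow> x"
        using LIMSEQ_inverse_real_of_nat_add by simp
      show "\<forall>\<^sub>F n in sequentially. x + inverse (real (Suc n)) \<in> {x..x + 1} \<and> x + inverse (real (Suc n)) \<noteq> x"
        by (auto simp: field_simps)
    qed
  qed
  then show ?thesis by (simp add: Ioc divide_inverse)
qed

lemma inv_char_nonneg: "0 \<le> inv_char M x"
  by (rule LIMSEQ_le_const[OF inv_char_eq_limit]) auto

text \<open>The measures agree on \<open>{x<..x + n}\<close>, hence on the rays
  \<open>{x<..}\<close> as increasing unions, and the rays determine the measure.\<close>

lemma density_inv_char: "M = density lborel (\<lambda>x. ennreal (inv_char M x))"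
proof (rule measure_eqI_lessThan)
  let ?D = "density lborel (\<lambda>x. ennreal (inv_char M x))"
  fix x :: real
  show "emeasure M {x<..} < \<infinity>" by (simp add: less_top[symmetric])
  have Ioc: "emeasure M {x<..x + real n} = emeasure ?D {x<..x + real n}" for n
  proof -
    have "emeasure M {x<..x + real n} = ennreal (\<integral>y. indicator {x..x + real n} y * inv_char M y \<partial>lborel)"
      by (simp add: emeasure_eq_measure measure_Ioc_eq_inv_char)
    also have "\<dots> = (\<integral>\<^sup>+y. ennreal (indicator {x..x + real n} y * inv_char M y) \<partial>lborel)"
      by (rule nn_integral_eq_integral[symmetric]) (auto simp: inv_char_integrable_Icc inv_char_nonneg)
    also have "\<dots> = (\<integral>\<^sup>+y. ennreal (inv_char M y) * indicator {x<..x + real n} y \<partial>lborel)"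
    proof (rule nn_integral_cong_AE)
      have "AE y in lborel. y \<noteq> x" by (rule AE_lborel_singleton)
      then show "AE y in lborel. ennreal (indicator {x..x + real n} y * inv_char M y)
        = ennreal (inv_char M y) * indicator {x<..x + real n} y"
        by eventually_elim (auto simp: indicator_def)
    qed
    also have "\<dots> = emeasure ?D {x<..x + real n}"
      by (simp add: emeasure_density)
    finally show ?thesis .
  qed
  have union: "{x<..} = (\<Union>n. {x<..x + real n})"
  proof safe
    fix y assume "y > x"
    moreover obtain n where "y - x \<le> real n" using real_arch_simple by blast
    ultimately show "y \<in> (\<Union>n. {x<..x + real n})" by (auto intro!: exI[of _ n])
  qed auto
  have inc: "incseq (\<lambda>n. {x<..x + real n})" by (auto simp: incseq_def)
  show "emeasure M {x<..} = emeasure ?D {x<..}"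
  proof -
    have "emeasure M {x<..} = (SUP n. emeasure M {x<..x + real n})"
      unfolding union by (rule SUP_emeasure_incseq[symmetric]) (auto simp: inc)
    also have "\<dots> = (SUP n. emeasure ?D {x<..x + real n})"
      by (simp add: Ioc)
    also have "\<dots> = emeasure ?D {x<..}"
      unfolding union by (rule SUP_emeasure_incseq) (auto simp: inc)
    finally show ?thesis .
  qed
qed auto

end

end

section \<open>Analyticity of the density from decay of the characteristic function\<close>

lemma integrable_inverse_1_plus_square_lborel: "integrable lborel (\<lambda>x::real. inverse (1 + x^2))"
  using integrable_inverse_1_plus_square by (simp add: set_integrable_def)

lemma (in real_distribution) char_integrableI:
  assumes "\<And>t. norm (char M t) * (1 + t^2) \<le> C"
  shows "integrable lborel (char M)"
proof (rule Bochner_Integration.integrable_bound)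
  show "integrable lborel (\<lambda>x::real. C * inverse (1 + x^2))"
    using integrable_inverse_1_plus_square_lborel by simp
  show "AE t in lborel. norm (char M t) \<le> norm (C * inverse (1 + t^2))"
  proof (rule AE_I2)
    fix t :: real
    have "(1 + t^2) * inverse (1 + t^2) = 1"
      using zero_le_power2[of t] by (intro right_inverse) linarith
    then have "norm (char M t) = (norm (char M t) * (1 + t^2)) * inverse (1 + t^2)"
      by (metis mult.assoc mult_1_right)
    also have "\<dots> \<le> C * inverse (1 + t^2)"
      using assms by (intro mult_right_mono) auto
    also have "\<dots> \<le> norm (C * inverse (1 + t^2))" by simp
    finally show "norm (char M t) \<le> norm (C * inverse (1 + t^2))" .
  qed
qed auto

text \<open>Expand the exponential in powers of \<open>x\<close> and integrate termwise. The decay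
  bounds for \<open>n\<close> and \<open>n + 2\<close> together control
  \<open>(1 + t^2) * |t|^n * |char M t|\<close>, so the \<open>n\<close>-th term is dominated by a
  multiple of \<open>1 / (1 + t^2)\<close>.\<close>

lemma (in real_distribution) inv_char_entire:
  fixes C :: "nat \<Rightarrow> real"
  assumes decay: "\<And>j t. norm (char M t) * \<bar>t\<bar> ^ j \<le> C j"
    and summable: "\<And>R. summable (\<lambda>n. R ^ n / fact n * (C n + C (n + 2)))"
  obtains c where "\<And>x. (\<lambda>n. c n * x ^ n) sums inv_char M x"
proof -
  define P where "P = (\<integral>t. inverse (1 + t^2) \<partial>(lborel :: real measure))"
  define f where "f x n t = (- \<i> * of_real t * of_real x) ^ n /\<^sub>R fact n * char M t" for x t :: real and n :: nat
  have norm_f: "norm (f x n t) \<le> \<bar>x\<bar> ^ n / fact n * (C n + C (n + 2)) * inverse (1 + t^2)" for x t n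
  proof -
    have "(1 + t^2) * inverse (1 + t^2) = 1"
      using zero_le_power2[of t] by (intro right_inverse) linarith
    moreover have "norm (f x n t) = \<bar>x\<bar> ^ n / fact n * (norm (char M t) * \<bar>t\<bar> ^ n)"
      by (simp add: f_def norm_mult norm_power power_mult_distrib divide_inverse)
    ultimately have "norm (f x n t) = \<bar>x\<bar> ^ n / fact n * (norm (char M t) * \<bar>t\<bar> ^ n * (1 + t^2)) * inverse (1 + t^2)"
      by (metis mult.assoc mult_1_right)
    also have "norm (char M t) * \<bar>t\<bar> ^ n * (1 + t^2) = norm (char M t) * \<bar>t\<bar> ^ n + norm (char M t) * \<bar>t\<bar> ^ (n + 2)"
      by (simp add: algebra_simps power_add power2_eq_square)
    also have "\<bar>x\<bar> ^ n / fact n * \<dots> * inverse (1 + t^2) \<le> \<bar>x\<bar> ^ n / fact n * (C n + C (n + 2)) * inverse (1 + t^2)"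
      by (intro mult_right_mono mult_left_mono add_mono decay) auto
    finally show ?thesis .
  qed
  have f_meas [measurable]: "f x n \<in> borel_measurable lborel" for x n
    unfolding f_def by measurable
  have f_int: "integrable lborel (f x n)" for x n
  proof (rule Bochner_Integration.integrable_bound[OF _ f_meas])
    show "integrable lborel (\<lambda>t::real. \<bar>x\<bar> ^ n / fact n * (C n + C (n + 2)) * inverse (1 + t^2))"
      using integrable_inverse_1_plus_square_lborel by simp
    show "AE t in lborel. norm (f x n t) \<le> norm (\<bar>x\<bar> ^ n / fact n * (C n + C (n + 2)) * inverse (1 + t^2))"
      by (intro AE_I2 order_trans[OF norm_f]) (unfold real_norm_def, rule abs_ge_self)
  qed
  have exp_sums: "(\<lambda>n. f x n t) sums (iexp (- (t * x)) * char M t)" for x t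
    using exp_converges[of "- \<i> * of_real t * of_real x", THEN sums_mult2, of "char M t"]
    by (simp add: f_def mult.assoc)
  have summable_f: "summable (\<lambda>n. norm (f x n t))" for x t
    using summable_norm_exp[of "- \<i> * of_real t * of_real x", THEN summable_mult2, of "norm (char M t)"]
    by (simp add: f_def norm_mult mult.assoc)
  have "(\<lambda>n. \<integral>t. f x n t \<partial>lborel) sums (\<integral>t. (\<Sum>n. f x n t) \<partial>lborel)" for x
  proof (rule sums_integral[OF f_int])
    show "AE t in lborel. summable (\<lambda>n. norm (f x n t))" using summable_f by simp
    show "summable (\<lambda>n. \<integral>t. norm (f x n t) \<partial>lborel)"
    proof (rule summable_comparison_test')
      show "summable (\<lambda>n. \<bar>x\<bar> ^ n / fact n * (C n + C (n + 2)) * P)"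
        by (intro summable_mult2 summable)
      fix n :: nat
      have "(\<integral>t. norm (f x n t) \<partial>lborel) \<le> (\<integral>t. \<bar>x\<bar> ^ n / fact n * (C n + C (n + 2)) * inverse (1 + t^2) \<partial>lborel)"
        by (intro integral_mono norm_f) (use f_int integrable_inverse_1_plus_square_lborel in auto)
      then show "norm (\<integral>t. norm (f x n t) \<partial>lborel) \<le> \<bar>x\<bar> ^ n / fact n * (C n + C (n + 2)) * P"
        by (simp add: P_def)
    qed
  qed
  then have "(\<lambda>n. \<integral>t. f x n t \<partial>lborel) sums (\<integral>t. iexp (- (t * x)) * char M t \<partial>lborel)" for x
    by (simp only: sums_unique[OF exp_sums, symmetric])
  then have sums: "(\<lambda>n. Re (\<integral>t. f x n t \<partial>lborel) / (2 * pi)) sums inv_char M x" for x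
    unfolding inv_char_def by (intro sums_divide sums_Re)
  \<comment> \<open>The \<open>n\<close>-th integrand is homogeneous of degree \<open>n\<close> in
    \<open>x\<close>, so the coefficients are read off at \<open>x = 1\<close>.\<close>
  define c where "c n = Re (\<integral>t. f 1 n t \<partial>lborel) / (2 * pi)" for n
  have pow: "(- \<i> * of_real t * of_real x) ^ n = of_real (x ^ n) * (- \<i> * of_real t * of_real 1) ^ n" for x t :: real and n
  proof -
    have "- \<i> * of_real t * of_real x = of_real x * (- \<i> * of_real t * of_real 1)" by simp
    then show ?thesis by (simp only: power_mult_distrib of_real_power)
  qed
  have f_scale: "f x n t = of_real (x ^ n) * f 1 n t" for x n t
    unfolding f_def by (subst pow) simp
  have integral_scale: "(\<integral>t. f x n t \<partial>lborel) = of_real (x ^ n) * (\<integral>t. f 1 n t \<partial>lborel)" for x n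
    by (simp only: f_scale[of x n] integral_mult_right_zero)
  have "Re (\<integral>t. f x n t \<partial>lborel) / (2 * pi) = c n * x ^ n" for x n
    by (simp add: integral_scale[of x n] c_def del: of_real_power)
  then show ?thesis using sums that[of c] by simp
qed

text \<open>Convergence at all real points implies convergence on the complex plane. The identity
  theorem applies to this extension because the midpoint of the interval is a limit point of
  it.\<close>

lemma entire_constant_on_interval:
  fixes f :: "real \<Rightarrow> real"
  assumes sums: "\<And>x. (\<lambda>n. c n * x ^ n) sums f x"
    and "u < v" and const: "\<And>x. x \<in> {u<..<v} \<Longrightarrow> f x = d"
  shows "f x = d"
proof -
  define F where "F z = (\<Sum>n. of_real (c n) * z ^ n)" for z :: complex
  have F: "(\<lambda>n. of_real (c n) * z ^ n) sums F z" for z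
  proof -
    have "summable (\<lambda>n. complex_of_real (c n) * of_real (norm z + 1) ^ n)"
      using summable_of_real[OF sums_summable[OF sums[of "norm z + 1"]], where 'a = complex] by simp
    then have "summable (\<lambda>n. of_real (c n) * z ^ n)"
      by (rule powser_inside) simp
    then show ?thesis by (simp add: F_def summable_sums)
  qed
  have hol_ball: "F holomorphic_on ball 0 r" for r
    using F by (intro power_series_holomorphic[where a = "\<lambda>n. of_real (c n)"]) auto
  have "F field_differentiable at z" for z
    using hol_ball[of "norm z + 1"] by (rule holomorphic_on_imp_differentiable_at) auto
  then have hol: "F holomorphic_on UNIV"
    by (simp add: holomorphic_on_def)
  have real: "F (of_real x) = of_real (f x)" for x
    using sums_of_real[OF sums[of x], where 'a = complex] F[of "of_real x"] sums_unique2 by fastforce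
  let ?m = "(u + v) / 2"
  have "F (of_real x) - of_real d = 0"
  proof (rule analytic_continuation[of "\<lambda>z. F z - of_real d" UNIV "of_real ` {u<..<v}" "of_real ?m"])
    show "(complex_of_real ?m) islimpt of_real ` {u<..<v}"
    proof (rule islimpt_isCont_image)
      show "?m islimpt {u<..<v}"
        using assms(2) by (intro interior_limit_point) (auto simp: interior_open)
      show "\<forall>\<^sub>F y in at ?m. complex_of_real y \<noteq> complex_of_real ?m"
        unfolding of_real_eq_iff by (rule eventually_neq_at_within)
    qed (auto intro: continuous_intros)
    show "F z - of_real d = 0" if "z \<in> of_real ` {u<..<v}" for z
      using that const by (auto simp: real)
  qed (use hol in \<open>auto intro!: holomorphic_intros\<close>)
  then show ?thesis by (simp add: real)
qed

section \<open>Uniqueness of the local maximum\<close>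

text \<open>The finite integral yields a global maximum \<open>m\<close>. At another local maximum
  \<open>y\<close>, quasi-concavity between \<open>y\<close> and \<open>m\<close> gives values at
  least \<open>f y\<close>, local maximality gives values at most \<open>f y\<close>, and
  \<open>f\<close> would be constant on an interval.\<close>

lemma quasiconcave_unique_local_maximum:
  fixes f :: "real \<Rightarrow> real"
  assumes cont: "continuous_on UNIV f" and nonneg: "\<And>x. 0 \<le> f x"
    and int: "(\<integral>\<^sup>+x. ennreal (f x) \<partial>lborel) = 1"
    and qc: "\<And>x y z. x < y \<Longrightarrow> y < z \<Longrightarrow> min (f x) (f z) \<le> f y"
    and nonconst: "\<And>u v. u < v \<Longrightarrow> \<exists>x\<in>{u<..<v}. \<exists>y\<in>{u<..<v}. f x \<noteq> f y"
  shows "\<exists>!x. local_maximum f x"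
proof -
  have no_plateau: "\<exists>x\<in>{l..u}. f x < e" if "e > 0" "l \<le> u" "1 < e * (u - l)" for e l u
  proof (rule ccontr)
    assume "\<not> (\<exists>x\<in>{l..u}. f x < e)"
    then have ge: "\<And>x. x \<in> {l..u} \<Longrightarrow> e \<le> f x" by force
    have "ennreal (e * (u - l)) = (\<integral>\<^sup>+x. ennreal e * indicator {l..u} x \<partial>lborel)"
      using that by (simp add: nn_integral_cmult_indicator ennreal_mult)
    also have "\<dots> \<le> (\<integral>\<^sup>+x. ennreal (f x) \<partial>lborel)"
      using ge by (intro nn_integral_mono) (auto simp: indicator_def ennreal_leI)
    finally show False using int that by simp
  qed
  obtain x0 where x0: "f x0 > 0"
  proof (rule ccontr)
    assume "\<not> thesis"
    then have "f x = 0" for x using that nonneg by (metis order_le_less)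
    then show False using int by simp
  qed
  \<comment> \<open>Values at least \<open>f x0\<close> on an interval of length
    \<open>2 / f x0\<close> would make the integral at least 2.\<close>
  have "\<exists>x\<in>{x0 - 2 / f x0..x0}. f x < f x0" "\<exists>x\<in>{x0..x0 + 2 / f x0}. f x < f x0"
    by (rule no_plateau; use x0 in simp)+
  then obtain x1 x2 where "x1 \<le> x0" "f x1 < f x0" "x0 \<le> x2" "f x2 < f x0"
    by auto
  then have x1: "x1 < x0" "f x1 < f x0" and x2: "x0 < x2" "f x2 < f x0"
    by (auto simp: le_less)
  have "\<exists>m\<in>{x1..x2}. \<forall>y\<in>{x1..x2}. f y \<le> f m"
    using x1 x2 by (intro continuous_attains_sup) (auto intro: continuous_on_subset[OF cont])
  then obtain m where m: "m \<in> {x1..x2}" "\<And>y. y \<in> {x1..x2} \<Longrightarrow> f y \<le> f m" by blast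
  \<comment> \<open>Since \<open>f x1\<close> and \<open>f x2\<close> lie below \<open>f x0\<close>,
    quasi-concavity bounds \<open>f\<close> by \<open>f x1\<close> to the left of \<open>x1\<close>
    and by \<open>f x2\<close> to the right of \<open>x2\<close>.\<close>
  have max: "f y \<le> f m" for y
  proof -
    have "f x1 \<le> f m" "f x2 \<le> f m" using m x1 x2 by auto
    moreover have "f y \<le> f x1" if "y < x1" using qc[OF that, of x0] x1 by (auto simp: min_def split: if_splits)
    moreover have "f y \<le> f x2" if "y > x2" using qc[of x0 x2 y] that x2 by (auto simp: min_def split: if_splits)
    ultimately show ?thesis using m(2)[of y] by force
  qed
  show ?thesis
  proof (rule ex1I)
    show "local_maximum f m" using max by (simp add: local_maximum_def)
  next
    fix y assume "local_maximum f y"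
    then obtain e where e: "e > 0" "\<And>z. dist z y < e \<Longrightarrow> f z \<le> f y"
      unfolding local_maximum_def eventually_nhds_metric by blast
    show "y = m"
    proof (rule ccontr)
      assume "y \<noteq> m"
      then consider "y < m" | "m < y" by linarith
      then show False
      proof cases
        case 1
        define d where "d = min m (y + e)"
        have d: "y < d" using 1 e by (simp add: d_def)
        have "f z = f y" if "z \<in> {y<..<d}" for z
          using qc[of y z m] e(2)[of z] max[of y] that by (force simp: d_def dist_real_def)
        then show False using nonconst[OF d] by auto
      next
        case 2
        define d where "d = max m (y - e)"
        have d: "d < y" using 2 e by (simp add: d_def)
        have "f z = f y" if "z \<in> {d<..<y}" for z
          using qc[of m z y] e(2)[of z] max[of y] that by (force simp: d_def dist_real_def)
        then show False using nonconst[OF d] by auto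
      qed
    qed
  qed
qed

section \<open>The limit law\<close>

text \<open>Up to a factor exponential in \<open>n\<close>, \<open>C n\<close> is
  \<open>n^(a n)\<close> while \<open>fact n\<close> is \<open>n^n\<close>; as \<open>a < 1\<close>,
  the factorial wins against every \<open>R ^ n\<close>.\<close>

lemma summable_decay_bound:
  fixes a K R :: real
  assumes "0 < a" "a < 1" "1 \<le> K"
  defines "C \<equiv> \<lambda>j. (K * real (j + 1)) powr (real j * a)"
  shows "summable (\<lambda>n. R ^ n / fact n * (C n + C (n + 2)))"
proof (rule summable_comparison_test_ev)
  \<comment> \<open>The factor \<open>exp 1\<close> pays for
    \<open>n^n \<le> exp n * fact n\<close>, \<open>|R| + 1\<close> for the power of
    \<open>R\<close>, and 4 leaves a remainder \<open>2 / 4^n\<close>.\<close>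
  define c where "c = ln (4 * exp 1 * (\<bar>R\<bar> + 1))"
  have C_pos: "0 < C j" for j using assms by (simp add: C_def)
  have C_mono: "C n \<le> C (n + 2)" for n
  proof -
    have "C n \<le> (K * real (n + 1)) powr (real (n + 2) * a)"
      unfolding C_def using assms by (intro powr_mono mult_right_mono mult_ge1_I) auto
    also have "\<dots> \<le> C (n + 2)"
      unfolding C_def using assms by (intro powr_mono2 mult_left_mono) auto
    finally show ?thesis .
  qed
  have fact_ge: "real n ^ n \<le> exp (real n) * fact n" for n
  proof -
    have "real n ^ n / fact n \<le> exp (real n)"
      using sum_le_suminf[OF summable_exp_generic, of "{n}" "real n"] 
      by (simp add: exp_def divide_inverse mult.commute)
    then show ?thesis by (simp add: field_simps)
  qed
  have "eventually (\<lambda>n::nat. c * real n + (real n + 2) * a * ln (K * (real n + 3)) \<le> real n * ln (real n)) at_top"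
    using assms(1-3) by real_asymp
  then show "\<forall>\<^sub>F n in sequentially. norm (R ^ n / fact n * (C n + C (n + 2))) \<le> (1/2) ^ n"
    using eventually_ge_at_top[of 1]
  proof eventually_elim
    case (elim n)
    have "C (n + 2) = exp ((real n + 2) * a * ln (K * (real n + 3)))"
    proof -
      have "real (n + 2 + 1) = real n + 3" "real (n + 2) = real n + 2" by simp_all
      moreover have "K * (real n + 3) \<noteq> 0" using assms(3) by auto
      ultimately show ?thesis by (simp only: C_def powr_def) simp
    qed
    moreover have "exp (c * real n) = (4 * exp 1 * (\<bar>R\<bar> + 1)) ^ n"
      unfolding c_def by (subst mult.commute, subst exp_of_nat_mult) simp
    moreover have "exp (real n * ln (real n)) = real n ^ n"
      using elim by (simp add: exp_of_nat_mult)
    moreover have "exp (c * real n + (real n + 2) * a * ln (K * (real n + 3))) \<le> exp (real n * ln (real n))"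
      using elim by simp
    ultimately have "(4 * exp 1 * (\<bar>R\<bar> + 1)) ^ n * C (n + 2) \<le> real n ^ n"
      by (simp add: exp_add)
    also have "\<dots> \<le> exp 1 ^ n * fact n"
      using fact_ge[of n] by (simp flip: exp_of_nat_mult)
    finally have *: "(4 * (\<bar>R\<bar> + 1)) ^ n * C (n + 2) \<le> fact n"
      by (simp add: power_mult_distrib mult_ac)
    have "norm (R ^ n / fact n * (C n + C (n + 2))) = \<bar>R\<bar> ^ n / fact n * (C n + C (n + 2))"
      using C_pos[of n] C_pos[of "n + 2"] by (simp add: abs_mult power_abs)
    also have "\<dots> \<le> (\<bar>R\<bar> + 1) ^ n / fact n * (2 * C (n + 2))"
      using C_pos[of n] C_mono[of n]
      by (intro mult_mono divide_right_mono power_mono) auto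
    also have "\<dots> = ((4 * (\<bar>R\<bar> + 1)) ^ n * C (n + 2) / fact n) * (2 / 4 ^ n)"
      unfolding power_mult_distrib by simp
    also have "\<dots> \<le> 1 * (2 / 4 ^ n)"
      using * by (intro mult_right_mono) (auto simp: field_simps)
    also have "\<dots> \<le> (1/2) ^ n"
    proof -
      have "(2::real) \<le> 2 ^ n" using elim(2) power_increasing[of 1 n "2::real"] by simp
      moreover have "(4::real) ^ n = 2 ^ n * 2 ^ n" by (simp flip: power_mult_distrib)
      ultimately show ?thesis by (simp add: power_divide field_simps)
    qed
    finally show ?case .
  qed
qed (simp add: summable_geometric)

lemma cmod_one_minus_iexp: "cmod (1 - iexp (2 * x)) = 2 * \<bar>sin x\<bar>"
proof -
  have "1 - iexp (2 * x) = - (2 * \<i>) * of_real (sin x) * iexp x"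
    by (simp add: complex_eq_iff cos_double_sin sin_double Re_exp Im_exp power2_eq_square)
  then show ?thesis by (simp add: norm_mult)
qed

lemma exists_le_average:
  fixes f :: "'b \<Rightarrow> real"
  assumes "finite S" "S \<noteq> {}"
  obtains k where "k \<in> S" "f k \<le> sum f S / card S"
proof (rule ccontr)
  assume "\<not> thesis"
  then have "\<And>k. k \<in> S \<Longrightarrow> sum f S / card S < f k" using that by force
  then have "(\<Sum>k\<in>S. sum f S / card S) < sum f S"
    using assms by (intro sum_strict_mono) auto
  then show False using assms by simp
qed

lemma exists_ge_average:
  fixes f :: "'b \<Rightarrow> real"
  assumes "finite S" "S \<noteq> {}"
  obtains k where "k \<in> S" "sum f S / card S \<le> f k"
  using exists_le_average[OF assms, of "\<lambda>k. - f k"] by (auto simp: sum_negf)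

text \<open>Choose indices in \<open>I\<close> and \<open>K\<close> with values at least the average
  and one in \<open>J\<close> with value at most the average, and compare these pointwise.\<close>

lemma up_law_average_quasiconcave:
  assumes a: "0 < a" "a < 1" and "n \<ge> 1"
    and "finite I" "finite J" "finite K" "I \<noteq> {}" "J \<noteq> {}" "K \<noteq> {}"
    and "\<And>i j. i \<in> I \<Longrightarrow> j \<in> J \<Longrightarrow> i \<le> j" "\<And>j k. j \<in> J \<Longrightarrow> k \<in> K \<Longrightarrow> j \<le> k"
  shows "min (sum (up_law a n) I / card I) (sum (up_law a n) K / card K) \<le> sum (up_law a n) J / card J"
proof -
  obtain i where i: "i \<in> I" "sum (up_law a n) I / card I \<le> up_law a n i"
    using exists_ge_average[of I] assms by blast
  obtain k where k: "k \<in> K" "sum (up_law a n) K / card K \<le> up_law a n k"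
    using exists_ge_average[of K] assms by blast
  obtain j where j: "j \<in> J" "up_law a n j \<le> sum (up_law a n) J / card J"
    using exists_le_average[of J] assms by blast
  have "min (up_law a n i) (up_law a n k) \<le> up_law a n j"
    using assms i j k by (intro up_law_quasiconcave) auto
  then show ?thesis using i j k by linarith
qed

locale elephant_random_walk_limit = elephant_random_walk M "(1 + a) / 2" 1 X U E
  for M :: "'a measure" and a :: real and X :: "nat \<Rightarrow> 'a \<Rightarrow> int"
    and U :: "nat \<Rightarrow> 'a \<Rightarrow> nat" and E :: "nat \<Rightarrow> 'a \<Rightarrow> int" +
  fixes L :: "'a \<Rightarrow> real"
  assumes a: "0 < a" "a < 1"
    and L_measurable [measurable]: "L \<in> borel_measurable M"
    and converges: "AE \<omega> in M. (\<lambda>n. real n powr (- a) * real_of_int (walk_position X n \<omega>)) \<longlonglongrightarrow> L \<omega>"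
begin

text \<open>Almost surely the rescaled walk, expressed through \<open>up_steps\<close>, whose law is
  known exactly.\<close>

definition scaled :: "nat \<Rightarrow> 'a \<Rightarrow> real" where
  "scaled n \<omega> = real n powr (- a) * (2 * real_of_int (up_steps n \<omega>) - real n)"

abbreviation \<mu> :: "real measure" where
  "\<mu> \<equiv> distr M borel L"

lemma scaled_measurable [measurable]: "scaled n \<in> borel_measurable M"
  unfolding scaled_def by measurable

lemma scaled_tendsto: "AE \<omega> in M. (\<lambda>n. scaled n \<omega>) \<longlonglongrightarrow> L \<omega>"
  using converges AE_walk_position by eventually_elim (simp add: scaled_def)

lemma prob_eq_up_law: 
  assumes "n \<ge> 1"
  shows "prob {\<omega> \<in> space M. up_steps n \<omega> = k} = up_law a n k"
proof -
  have "2 * ((1 + a) / 2) - 1 = a" by (simp add: field_simps)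
  then show ?thesis using prob_up_steps[OF refl assms] by (simp only:)
qed

lemma prob_up_steps_in:
  assumes "n \<ge> 1" "finite S"
  shows "prob {\<omega> \<in> space M. up_steps n \<omega> \<in> S} = sum (up_law a n) S"
proof -
  have "prob {\<omega> \<in> space M. up_steps n \<omega> \<in> S} = prob (\<Union>k\<in>S. {\<omega> \<in> space M. up_steps n \<omega> = k})"
    by (rule arg_cong[where f = prob]) auto
  also have "\<dots> = (\<Sum>k\<in>S. prob {\<omega> \<in> space M. up_steps n \<omega> = k})"
    using assms(2) by (intro finite_measure_finite_Union) (auto simp: disjoint_family_on_def)
  finally show ?thesis using assms(1) by (simp add: prob_eq_up_law)
qed

lemma expectation_up_steps:
  fixes g :: "int \<Rightarrow> complex"
  assumes "n \<ge> 1"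
  shows "(\<integral>\<omega>. g (up_steps n \<omega>) \<partial>M) = (\<Sum>k\<in>{1..int n}. of_real (up_law a n k) * g k)"
proof -
  let ?A = "\<lambda>k. {\<omega> \<in> space M. up_steps n \<omega> = k}"
  have "(\<integral>\<omega>. g (up_steps n \<omega>) \<partial>M) = (\<integral>\<omega>. (\<Sum>k\<in>{0..int n}. indicator (?A k) \<omega> *\<^sub>R g k) \<partial>M)"
  proof (rule integral_cong_AE)
    show "AE \<omega> in M. g (up_steps n \<omega>) = (\<Sum>k\<in>{0..int n}. indicator (?A k) \<omega> *\<^sub>R g k)"
      using AE_up_steps_range[of n] AE_space
    proof eventually_elim
      case (elim \<omega>)
      have "(\<Sum>k\<in>{0..int n}. indicator (?A k) \<omega> *\<^sub>R g k)
         = (\<Sum>k\<in>{0..int n}. if k = up_steps n \<omega> then g k else 0)"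
        using elim by (intro sum.cong) (auto simp: indicator_def)
      then show ?case using elim by simp
    qed
  qed measurable
  also have "\<dots> = (\<Sum>k\<in>{0..int n}. prob (?A k) *\<^sub>R g k)"
    by (subst Bochner_Integration.integral_sum) (auto simp: emeasure_eq_measure)
  also have "\<dots> = (\<Sum>k\<in>{0..int n}. of_real (up_law a n k) * g k)"
    using assms by (simp add: prob_eq_up_law scaleR_conv_of_real)
  also have "\<dots> = (\<Sum>k\<in>{1..int n}. of_real (up_law a n k) * g k)"
    by (rule sum_int_extend) (auto simp: up_law_support[OF assms])
  finally show ?thesis .
qed

sublocale limit_law: real_distribution \<mu>
  by (rule real_distribution_distr) simp

lemma char_tendsto: "(\<lambda>n. \<integral>\<omega>. iexp (t * scaled n \<omega>) \<partial>M) \<longlonglongrightarrow> char \<mu> t"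
proof -
  have "(\<lambda>n. \<integral>\<omega>. iexp (t * scaled n \<omega>) \<partial>M) \<longlonglongrightarrow> (\<integral>\<omega>. iexp (t * L \<omega>) \<partial>M)"
  proof (rule integral_dominated_convergence[where w = "\<lambda>_. 1"])
    show "AE \<omega> in M. (\<lambda>n. iexp (t * scaled n \<omega>)) \<longlonglongrightarrow> iexp (t * L \<omega>)"
      using scaled_tendsto by eventually_elim (auto intro!: tendsto_intros)
  qed auto
  then show ?thesis by (simp add: char_def integral_distr)
qed

text \<open>Up to a factor of modulus 1, the expectation is the generating function of the law at
  \<open>iexp (2 * s)\<close> with \<open>s = t * n^(-a)\<close>, a point at distance
  \<open>2 * |sin s|\<close> from 1.\<close>

lemma norm_expectation_scaled_le:
  assumes "n \<ge> 1"
  shows "(2 * \<bar>sin (t * real n powr (- a))\<bar>) ^ j * norm (\<integral>\<omega>. iexp (t * scaled n \<omega>) \<partial>M) \<le> diff_norm a j n"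
proof -
  let ?s = "t * real n powr (- a)"
  let ?z = "iexp (2 * ?s)"
  have "iexp (t * scaled n \<omega>) = iexp (- (?s * real n)) * ?z powi (up_steps n \<omega>)" for \<omega>
    by (simp add: scaled_def exp_power_int flip: exp_add) (simp add: algebra_simps)
  then have "(\<integral>\<omega>. iexp (t * scaled n \<omega>) \<partial>M) = iexp (- (?s * real n)) * (\<integral>\<omega>. ?z powi (up_steps n \<omega>) \<partial>M)"
    by (simp only: integral_mult_right_zero)
  then have "norm (\<integral>\<omega>. iexp (t * scaled n \<omega>) \<partial>M) = norm (\<Sum>k\<in>{1..int n}. of_real (up_law a n k) * ?z powi k)"
    by (simp only: expectation_up_steps[OF assms] norm_mult norm_exp_i_times mult_1)
  moreover have "norm ?z = 1" by (rule norm_exp_i_times)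
  ultimately show ?thesis
    using norm_generating_function_le[OF assms, of ?z j a] unfolding cmod_one_minus_iexp by simp
qed

section \<open>Decay of the characteristic function of the limit\<close>

text \<open>A positive integer not below \<open>2 * a / (1 - a)\<close>: its multiple by
  \<open>j + 1\<close> meets the threshold of \<open>diff_norm_decay\<close>.\<close>

definition decay_const :: real where
  "decay_const = real (nat \<lceil>2 * a / (1 - a)\<rceil> + 1)"

text \<open>Multiply \<open>norm_expectation_scaled_le\<close> by \<open>n^(j * a)\<close>. The
  right side stays bounded by \<open>diff_norm_decay\<close>, on the left
  \<open>n^a * sin (t * n^(-a))\<close> tends to \<open>t\<close>, and the factors
  \<open>2 ^ j\<close> cancel.\<close>

lemma char_decay: "norm (char \<mu> t) * \<bar>t\<bar> ^ j \<le> (decay_const * real (j + 1)) powr (real j * a)"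
proof -
  define m where "m = nat \<lceil>2 * a / (1 - a)\<rceil> + 1"
  define n0 where "n0 = m * (j + 1)"
  have n0: "1 \<le> n0" "2 * a * real j \<le> (1 - a) * real n0"
  proof -
    have "2 * a / (1 - a) \<le> real m" unfolding m_def by linarith
    then have "2 * a \<le> (1 - a) * real m" using a by (simp add: field_simps)
    then have "2 * a * real (j + 1) \<le> (1 - a) * real m * real (j + 1)"
      by (intro mult_right_mono) auto
    moreover have "2 * a * real j \<le> 2 * a * real (j + 1)"
      using a by (intro mult_left_mono) auto
    moreover have "(1 - a) * real m * real (j + 1) = (1 - a) * real n0"
      by (simp only: n0_def of_nat_mult mult.assoc)
    ultimately show "2 * a * real j \<le> (1 - a) * real n0"
      by linarith
  qed (simp add: n0_def m_def)
  let ?E = "\<lambda>n. \<integral>\<omega>. iexp (t * scaled n \<omega>) \<partial>M"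
  have "(\<lambda>n. real n powr a * sin (t * real n powr (- a))) \<longlonglongrightarrow> t"
    using a by real_asymp
  then have "(\<lambda>n. (2 * \<bar>real n powr a * sin (t * real n powr (- a))\<bar>) ^ j * norm (?E n))
     \<longlonglongrightarrow> (2 * \<bar>t\<bar>) ^ j * norm (char \<mu> t)"
    by (intro tendsto_intros char_tendsto)
  moreover have "eventually (\<lambda>n. (2 * \<bar>real n powr a * sin (t * real n powr (- a))\<bar>) ^ j * norm (?E n)
      \<le> 2 ^ j * real n0 powr (real j * a)) sequentially"
    using eventually_ge_at_top[of n0]
  proof eventually_elim
    case (elim n)
    have n: "n \<ge> 1" using elim n0 by simp
    have "(2 * \<bar>real n powr a * sin (t * real n powr (- a))\<bar>) ^ j * norm (?E n)
      = ((2 * \<bar>sin (t * real n powr (- a))\<bar>) ^ j * norm (?E n)) * (real n powr a) ^ j"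
      by (simp add: abs_mult power_mult_distrib mult_ac)
    also have "\<dots> \<le> diff_norm a j n * (real n powr a) ^ j"
      by (intro mult_right_mono norm_expectation_scaled_le n) auto
    also have "(real n powr a) ^ j = real n powr (real j * a)"
      using n by (simp add: powr_power mult.commute)
    also have "diff_norm a j n * \<dots> \<le> 2 ^ j * real n0 powr (real j * a)"
      by (rule diff_norm_decay[OF a n0(1) elim n0(2)])
    finally show ?case .
  qed
  ultimately have "(2 * \<bar>t\<bar>) ^ j * norm (char \<mu> t) \<le> 2 ^ j * real n0 powr (real j * a)"
    by (intro tendsto_upperbound) auto
  then have "2 ^ j * (norm (char \<mu> t) * \<bar>t\<bar> ^ j) \<le> 2 ^ j * real n0 powr (real j * a)"
    by (simp only: power_mult_distrib mult_ac)
  moreover have "real n0 = decay_const * real (j + 1)"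
    by (simp only: n0_def decay_const_def m_def of_nat_mult)
  ultimately show ?thesis by simp
qed

lemma char_integrable: "integrable lborel (char \<mu>)"
proof (rule limit_law.char_integrableI)
  fix t
  show "norm (char \<mu> t) * (1 + t^2) \<le> (decay_const * real (0 + 1)) powr (real 0 * a) + (decay_const * real (2 + 1)) powr (real 2 * a)"
    using char_decay[of t 0] char_decay[of t 2] by (simp add: distrib_left)
qed

text \<open>A power series constant on an interval is constant on the line, and a constant density
  has total mass 0 or infinity, never 1.\<close>

lemma inv_char_nonconstant:
  assumes "u < v"
  shows "\<exists>x\<in>{u<..<v}. \<exists>y\<in>{u<..<v}. inv_char \<mu> x \<noteq> inv_char \<mu> y"
proof (rule ccontr)
  assume *: "\<not> ?thesis"
  obtain c where c: "\<And>x. (\<lambda>n. c n * x ^ n) sums inv_char \<mu> x"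
  proof (rule limit_law.inv_char_entire[OF char_decay])
    show "summable (\<lambda>n. R ^ n / fact n * ((decay_const * real (n + 1)) powr (real n * a)
        + (decay_const * real (n + 2 + 1)) powr (real (n + 2) * a)))" for R
      by (rule summable_decay_bound[OF a]) (simp add: decay_const_def)
  qed (rule that)
  have "(u + v) / 2 \<in> {u<..<v}" using assms by simp
  then have "inv_char \<mu> x = inv_char \<mu> ((u + v) / 2)" if "x \<in> {u<..<v}" for x
    using * that by blast
  then have "inv_char \<mu> x = inv_char \<mu> ((u + v) / 2)" for x
    by (rule entire_constant_on_interval[OF c assms])
  then obtain d where d: "\<And>x. inv_char \<mu> x = d" by metis
  have "emeasure \<mu> UNIV = emeasure (density lborel (\<lambda>x::real. ennreal d)) UNIV"
    using limit_law.density_inv_char[OF char_integrable] unfolding d by simp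
  also have "\<dots> = ennreal d * \<infinity>"
    by (simp add: emeasure_density nn_integral_cmult)
  finally have "ennreal d * \<infinity> = 1"
    using limit_law.emeasure_space_1 by simp
  then show False by (cases "ennreal d = 0") (auto simp: ennreal_mult_top)
qed

section \<open>Transfer of quasi-concavity to the limit\<close>

text \<open>The limit has no atoms, so almost surely \<open>L\<close> avoids both endpoints and the
  indicators converge; dominated convergence finishes.\<close>

lemma window_mass_tendsto:
  "(\<lambda>n. prob {\<omega> \<in> space M. scaled n \<omega> \<in> {x<..y}}) \<longlonglongrightarrow> measure \<mu> {x<..y}"
proof -
  have "AE \<omega> in M. L \<omega> \<noteq> z" for z
  proof -
    have "measure \<mu> {z} = 0" by (rule limit_law.prob_singleton_eq_0[OF char_integrable])
    then have "prob (L -` {z} \<inter> space M) = 0" by (simp add: measure_distr)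
    then have "AE \<omega> in M. \<omega> \<notin> L -` {z} \<inter> space M"
      by (subst (asm) prob_eq_0) auto
    then show ?thesis using AE_space by eventually_elim auto
  qed
  from this[of x] this[of y]
  have "(\<lambda>n. \<integral>\<omega>. indicator {x<..y} (scaled n \<omega>) \<partial>M) \<longlonglongrightarrow> (\<integral>\<omega>. indicat_real {x<..y} (L \<omega>) \<partial>M)"
  proof (intro integral_dominated_convergence[where w = "\<lambda>_. 1"])
    show "AE \<omega> in M. (\<lambda>n. indicator {x<..y} (scaled n \<omega>)) \<longlonglongrightarrow> indicat_real {x<..y} (L \<omega>)"
      using scaled_tendsto \<open>AE \<omega> in M. L \<omega> \<noteq> x\<close> \<open>AE \<omega> in M. L \<omega> \<noteq> y\<close>
    proof eventually_elim
      case (elim \<omega>)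
      have "eventually (\<lambda>n. scaled n \<omega> \<in> {x<..y} \<longleftrightarrow> L \<omega> \<in> {x<..y}) sequentially"
      proof -
        have "eventually (\<lambda>n. scaled n \<omega> \<le> z \<longleftrightarrow> L \<omega> \<le> z) sequentially" if "L \<omega> \<noteq> z" for z
        proof (cases "L \<omega> < z")
          case True
          from order_tendstoD(2)[OF elim(1) this] show ?thesis
            by eventually_elim (use True in auto)
        next
          case False
          then have "z < L \<omega>" using that by auto
          from order_tendstoD(1)[OF elim(1) this] show ?thesis
            by eventually_elim (use False that in auto)
        qed
        from this[OF elim(2)] this[OF elim(3)] show ?thesis
          by eventually_elim (simp flip: not_le)
      qed
      then have "eventually (\<lambda>n. indicator {x<..y} (scaled n \<omega>) = indicat_real {x<..y} (L \<omega>)) sequentially"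
        by eventually_elim (simp add: indicator_def)
      then show ?case by (rule tendsto_eventually)
    qed
  qed (auto simp: indicator_def)
  moreover have "(\<integral>\<omega>. indicat_real {x<..y} (Y \<omega>) \<partial>M) = prob {\<omega> \<in> space M. Y \<omega> \<in> {x<..y}}"
    if [measurable]: "Y \<in> borel_measurable M" for Y :: "'a \<Rightarrow> real"
  proof -
    have "(\<integral>\<omega>. indicat_real {x<..y} (Y \<omega>) \<partial>M) = (\<integral>\<omega>. indicat_real {\<omega> \<in> space M. Y \<omega> \<in> {x<..y}} \<omega> \<partial>M)"
      by (rule Bochner_Integration.integral_cong) (auto simp: indicator_def)
    then show ?thesis by simp
  qed
  moreover have "measure \<mu> {x<..y} = prob {\<omega> \<in> space M. L \<omega> \<in> {x<..y}}"
    by (simp add: measure_distr vimage_def Int_def conj_commute)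
  ultimately show ?thesis by simp
qed

text \<open>Obtained by solving \<open>x < n^(-a) * (2 * k - n) \<le> y\<close> for the integer
  \<open>k\<close>.\<close>

definition window :: "real \<Rightarrow> real \<Rightarrow> nat \<Rightarrow> int set" where
  "window x y n = {\<lfloor>(x * real n powr a + real n) / 2\<rfloor> + 1 .. \<lfloor>(y * real n powr a + real n) / 2\<rfloor>}"

lemma finite_window: "finite (window x y n)"
  by (simp add: window_def)

lemma scaled_in_iff_window:
  assumes "n \<ge> 1"
  shows "scaled n \<omega> \<in> {x<..y} \<longleftrightarrow> up_steps n \<omega> \<in> window x y n"
proof -
  define c where "c = real n powr a"
  have c: "c > 0" "real n powr (- a) = 1 / c"
    using assms by (auto simp: c_def powr_minus divide_inverse)
  have "x < scaled n \<omega> \<longleftrightarrow> (x * c + real n) / 2 < real_of_int (up_steps n \<omega>)"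
    "scaled n \<omega> \<le> y \<longleftrightarrow> real_of_int (up_steps n \<omega>) \<le> (y * c + real n) / 2"
    using c(1) unfolding scaled_def c(2) by (auto simp: field_simps)
  then show ?thesis
    unfolding window_def c_def[symmetric] by (auto simp: floor_less_iff le_floor_iff add1_zle_eq)
qed

lemma window_mass:
  assumes "n \<ge> 1"
  shows "prob {\<omega> \<in> space M. scaled n \<omega> \<in> {x<..y}} = sum (up_law a n) (window x y n)"
  unfolding scaled_in_iff_window[OF assms] by (rule prob_up_steps_in[OF assms finite_window])

text \<open>Before rounding, the endpoints differ by \<open>n^a * (y - x) / 2\<close>; the floors
  change this by at most 1.\<close>

lemma window_card_tendsto:
  assumes "x < y"
  shows "(\<lambda>n. real (card (window x y n)) / real n powr a) \<longlonglongrightarrow> (y - x) / 2"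
proof (rule tendsto_sandwich)
  show "(\<lambda>n. (y - x) / 2 - real n powr (- a)) \<longlonglongrightarrow> (y - x) / 2"
    "(\<lambda>n. (y - x) / 2 + real n powr (- a)) \<longlonglongrightarrow> (y - x) / 2"
    using a by real_asymp+
  have bounds: "(y - x) / 2 - real n powr (- a) \<le> real (card (window x y n)) / real n powr a
      \<and> real (card (window x y n)) / real n powr a \<le> (y - x) / 2 + real n powr (- a)" if "n \<ge> 1" for n
  proof -
    define c where "c = real n powr a"
    have c: "c > 0" "real n powr (- a) = 1 / c"
      using that by (auto simp: c_def powr_minus divide_inverse)
    define \<alpha> \<beta> where "\<alpha> = (x * c + real n) / 2" and "\<beta> = (y * c + real n) / 2"
    have "\<alpha> \<le> \<beta>" using assms c by (simp add: \<alpha>_def \<beta>_def)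
    then have "\<lfloor>\<alpha>\<rfloor> \<le> \<lfloor>\<beta>\<rfloor>" by (rule floor_mono)
    then have "real (card (window x y n)) = real_of_int \<lfloor>\<beta>\<rfloor> - real_of_int \<lfloor>\<alpha>\<rfloor>"
      by (simp add: window_def \<alpha>_def \<beta>_def c_def)
    moreover have "\<beta> - \<alpha> - 1 \<le> real_of_int \<lfloor>\<beta>\<rfloor> - real_of_int \<lfloor>\<alpha>\<rfloor>" "real_of_int \<lfloor>\<beta>\<rfloor> - real_of_int \<lfloor>\<alpha>\<rfloor> \<le> \<beta> - \<alpha> + 1"
      by linarith+
    moreover have "\<beta> - \<alpha> = c * ((y - x) / 2)" by (simp add: \<alpha>_def \<beta>_def field_simps)
    ultimately have "c * ((y - x) / 2) - 1 \<le> real (card (window x y n))" "real (card (window x y n)) \<le> c * ((y - x) / 2) + 1"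
      by simp_all
    then have "(c * ((y - x) / 2) - 1) / c \<le> real (card (window x y n)) / c"
        "real (card (window x y n)) / c \<le> (c * ((y - x) / 2) + 1) / c"
      using c(1) by (intro divide_right_mono; simp)+
    then show ?thesis
      using c(1) unfolding c(2) c_def[symmetric] by (simp add: add_divide_distrib diff_divide_distrib)
  qed
  show "\<forall>\<^sub>F n in sequentially. (y - x) / 2 - real n powr (- a) \<le> real (card (window x y n)) / real n powr a"
    "\<forall>\<^sub>F n in sequentially. real (card (window x y n)) / real n powr a \<le> (y - x) / 2 + real n powr (- a)"
    using bounds by (auto simp: eventually_at_top_linorder)
qed

text \<open>Averages are needed because windows of intervals of equal length may differ in
  cardinality.\<close>

lemma window_average_tendsto:
  assumes "x < y"
  shows "(\<lambda>n. sum (up_law a n) (window x y n) / real (card (window x y n)) * real n powr a)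
    \<longlonglongrightarrow> measure \<mu> {x<..y} / ((y - x) / 2)"
proof (rule Lim_transform_eventually)
  show "(\<lambda>n. prob {\<omega> \<in> space M. scaled n \<omega> \<in> {x<..y}} / (real (card (window x y n)) / real n powr a))
    \<longlonglongrightarrow> measure \<mu> {x<..y} / ((y - x) / 2)"
    using assms by (intro tendsto_divide window_mass_tendsto window_card_tendsto) auto
  show "\<forall>\<^sub>F n in sequentially. prob {\<omega> \<in> space M. scaled n \<omega> \<in> {x<..y}} / (real (card (window x y n)) / real n powr a)
     = sum (up_law a n) (window x y n) / real (card (window x y n)) * real n powr a"
    using eventually_ge_at_top[of 1] by eventually_elim (simp only: window_mass, simp)
qed

lemma window_nonempty:
  assumes "x < y"
  shows "\<forall>\<^sub>F n in sequentially. window x y n \<noteq> {}"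
proof -
  have "\<forall>\<^sub>F n in sequentially. real (card (window x y n)) / real n powr a > 0"
    using assms by (intro order_tendstoD(1)[OF window_card_tendsto]) auto
  then show ?thesis by eventually_elim auto
qed

lemma window_ordered:
  assumes "y \<le> x'" "i \<in> window x y n" "j \<in> window x' y' n"
  shows "i \<le> j"
proof -
  have "\<lfloor>(y * real n powr a + real n) / 2\<rfloor> \<le> \<lfloor>(x' * real n powr a + real n) / 2\<rfloor>"
    using assms(1) by (intro floor_mono divide_right_mono add_right_mono mult_right_mono) auto
  then show ?thesis using assms by (auto simp: window_def)
qed

text \<open>For large \<open>n\<close> the three windows are nonempty and ordered, so
  \<open>up_law_average_quasiconcave\<close> applies; in the limit all three masses are divided by
  the same \<open>h / 2\<close>.\<close>

lemma interval_mass_quasiconcave: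
  assumes "h > 0" "x + h \<le> y" "y + h \<le> z"
  shows "min (measure \<mu> {x<..x + h}) (measure \<mu> {z<..z + h}) \<le> measure \<mu> {y<..y + h}"
proof -
  let ?A = "\<lambda>x n. sum (up_law a n) (window x (x + h) n) / real (card (window x (x + h) n))"
  have lim: "(\<lambda>n. ?A x n * real n powr a) \<longlonglongrightarrow> measure \<mu> {x<..x + h} / (h / 2)" for x
    using window_average_tendsto[of x "x + h"] assms(1) by simp
  have ne: "\<forall>\<^sub>F n in sequentially. window x (x + h) n \<noteq> {}" for x
    using assms(1) by (intro window_nonempty) auto
  have "min (measure \<mu> {x<..x + h} / (h / 2)) (measure \<mu> {z<..z + h} / (h / 2)) \<le> measure \<mu> {y<..y + h} / (h / 2)"
  proof (rule tendsto_le[OF _ lim[of y] tendsto_min[OF lim[of x] lim[of z]]])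
    show "\<forall>\<^sub>F n in sequentially. min (?A x n * real n powr a) (?A z n * real n powr a) \<le> ?A y n * real n powr a"
      using ne[of x] ne[of y] ne[of z] eventually_ge_at_top[of 1]
    proof eventually_elim
      case (elim n)
      have "min (?A x n) (?A z n) \<le> ?A y n"
        by (rule up_law_average_quasiconcave[OF a elim(4) finite_window finite_window finite_window elim(1-3)])
          (erule (1) window_ordered[OF assms(2)] window_ordered[OF assms(3)])+
      then have "min (?A x n) (?A z n) * real n powr a \<le> ?A y n * real n powr a"
        by (rule mult_right_mono) simp
      then show ?case by (simp add: min_mult_distrib_right)
    qed
  qed simp
  then show ?thesis using assms(1) unfolding min_le_iff_disj divide_le_cancel by auto
qed

text \<open>Let the common interval length tend to 0; eventually it is below \<open>y - x\<close>
  and \<open>z - y\<close>, so that the intervals do not overlap.\<close>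

lemma inv_char_quasiconcave:
  assumes "x < y" "y < z"
  shows "min (inv_char \<mu> x) (inv_char \<mu> z) \<le> inv_char \<mu> y"
proof -
  note lim = limit_law.inv_char_eq_limit[OF char_integrable]
  have small: "\<forall>\<^sub>F n in sequentially. inverse (real (Suc n)) < e" if "e > 0" for e
    using order_tendstoD(2)[OF LIMSEQ_inverse_real_of_nat that] .
  show ?thesis
  proof (rule tendsto_le[OF _ lim[of y] tendsto_min[OF lim[of x] lim[of z]]])
    show "\<forall>\<^sub>F n in sequentially.
       min (measure \<mu> {x<..x + inverse (real (Suc n))} * real (Suc n)) (measure \<mu> {z<..z + inverse (real (Suc n))} * real (Suc n))
       \<le> measure \<mu> {y<..y + inverse (real (Suc n))} * real (Suc n)"
      using small[OF diff_gt_0_iff_gt[THEN iffD2, OF assms(1)]] small[OF diff_gt_0_iff_gt[THEN iffD2, OF assms(2)]]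
    proof eventually_elim
      case (elim n)
      have "min (measure \<mu> {x<..x + inverse (real (Suc n))}) (measure \<mu> {z<..z + inverse (real (Suc n))})
        \<le> measure \<mu> {y<..y + inverse (real (Suc n))}"
        using elim by (intro interval_mass_quasiconcave) auto
      then have "min (measure \<mu> {x<..x + inverse (real (Suc n))}) (measure \<mu> {z<..z + inverse (real (Suc n))}) * real (Suc n)
        \<le> measure \<mu> {y<..y + inverse (real (Suc n))} * real (Suc n)"
        by (rule mult_right_mono) simp
      then show ?case by (simp add: min_mult_distrib_right)
    qed
  qed simp
qed

lemma limit_unimodal: "unimodal M L"
  unfolding unimodal_def
proof (intro exI conjI allI)
  note density = limit_law.density_inv_char[OF char_integrable]
  note nonneg = limit_law.inv_char_nonneg[OF char_integrable]
  note cont = limit_law.continuous_inv_char[OF char_integrable]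
  have [measurable]: "inv_char \<mu> \<in> borel_measurable borel"
    by (rule limit_law.inv_char_measurable[OF char_integrable])
  show "continuous_on UNIV (inv_char \<mu>)" by (rule cont)
  show "0 \<le> inv_char \<mu> x" for x by (rule nonneg)
  \<comment> \<open>\<open>distributed\<close> refers to \<open>lborel\<close>, whereas
    \<open>\<mu>\<close> lives on \<open>borel\<close>; the two have the same measurable
    sets.\<close>
  have "distr M lborel L = distr M borel L" by (rule distr_cong) auto
  then show "distributed M lborel L (\<lambda>x. ennreal (inv_char \<mu> x))"
    unfolding distributed_def using density by simp
  have "(\<integral>\<^sup>+x. ennreal (inv_char \<mu> x) \<partial>lborel) = emeasure (density lborel (\<lambda>x. ennreal (inv_char \<mu> x))) UNIV"
    by (simp add: emeasure_density)
  also have "\<dots> = 1"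
    using limit_law.emeasure_space_1 by (simp flip: density)
  finally show "\<exists>!x. local_maximum (inv_char \<mu>) x"
    by (intro quasiconcave_unique_local_maximum cont nonneg inv_char_quasiconcave inv_char_nonconstant)
qed

end

theorem theorem1p1:
  fixes a :: real and M :: "'a measure" and X :: "nat \<Rightarrow> 'a \<Rightarrow> int"
    and U :: "nat \<Rightarrow> 'a \<Rightarrow> nat" and E :: "nat \<Rightarrow> 'a \<Rightarrow> int" and L\<^sub>1 :: "'a \<Rightarrow> real"
  assumes "1 / 2 < a" and "a < 1"
    and "elephant_random_walk M ((1 + a) / 2) 1 X U E"
    and "L\<^sub>1 \<in> borel_measurable M"
    and "AE \<omega> in M. (\<lambda>n. real n powr (- a) * real_of_int (walk_position X n \<omega>)) \<longlonglongrightarrow> L\<^sub>1 \<omega>"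
  shows "unimodal M L\<^sub>1"
proof -
  interpret elephant_random_walk_limit M a X U E L\<^sub>1
    using assms by (intro elephant_random_walk_limit.intro elephant_random_walk_limit_axioms.intro) auto
  show ?thesis by (rule limit_unimodal)
qed

end
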